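(* Let $p\ge 1$ and $1\le d\le p$ be integers, let $\Sigma\in\mathbb{R}^{p\times p}$ be symmetric positive semidefinite, and let $g\sim N(0,\Sigma)$ in $\mathbb{R}^p$. Let $\lambda_1\ge\cdots\ge\lambda_p\ge 0$ be the eigenvalues of $\Sigma$ (with multiplicity, including zeros), and let $r=\operatorname{rank}(\Sigma)$. If $r\le d$, then $$\operatorname{OPT}_d(\Sigma)=\operatorname{KL}_d(\Sigma)=\operatorname{Tr}(\Sigma).$$ If $r>d$, then $$\operatorname{KL}_d(\Sigma)\le \operatorname{OPT}_d(\Sigma)\le c_{d,r}^{-1}\operatorname{KL}_d(\Sigma)\le \gamma_d^{-1}\operatorname{KL}_d(\Sigma),$$ where $$c_{d,r}:=1-\binom{r}{d}\left(\frac dr\right)^d\left(1-\frac dr\right)^{r+1-d},\qquad \gamma_d:=1-e^{-d}\frac{d^d}{d!}.$$ Moreover, as $d\to\infty$, $$\gamma_d^{-1}=1+\frac{1}{\sqrt{2\pi d}}+O(d^{-1})=1+O(d^{-1/2}).$$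
   Context: For $a=(a_1,\ldots,a_p)\in\mathbb{R}_+^p$ (nonnegative entries), let $a_{[1]}\ge\cdots\ge a_{[p]}$ be the non-increasing rearrangement of its coordinates, and for $1\le d\le p$ set $\operatorname{Top}_d(a):=\sum_{j=1}^d a_{[j]}$, equivalently $\operatorname{Top}_d(a)=\max_{S\subseteq\{1,\dots,p\},\,|S|=d}\sum_{i\in S}a_i$. Let $O(p)$ be the group of real orthogonal $p\times p$ matrices; an orthonormal basis is written $V=(v_1,\ldots,v_p)\in O(p)$ with columns $v_i$. For $g\sim N(0,\Sigma)$ (centered Gaussian vector, possibly degenerate) define $$\mathcal R_d(V;\Sigma):=\mathbb{E}\,\operatorname{Top}_d\bigl((v_1^\top g)^2,\ldots,(v_p^\top g)^2\bigr),\qquad \operatorname{OPT}_d(\Sigma):=\sup_{V\in O(p)}\mathcal R_d(V;\Sigma).$$ With $Z_1,\ldots,Z_p$ independent standard Gaussian random variables and $\lambda_1\ge\cdots\ge\lambda_p\ge0$ the eigenvalues of $\Sigma$, define $$\operatorname{KL}_d(\Sigma):=\mathbb{E}\,\operatorname{Top}_d\bigl(\lambda_1Z_1^2,\ldots,\lambda_pZ_p^2\bigr).$$ *)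

theory Defs
  imports
    "HOL-Probability.Probability"
    "HOL-Computational_Algebra.Polynomial"
    "HOL-Library.Landau_Symbols"
begin

definition decr_rearrangement :: "'i set \<Rightarrow> ('i \<Rightarrow> real) \<Rightarrow> real list" where
  "decr_rearrangement I a = rev (sorted_list_of_multiset (image_mset a (mset_set I)))"

text \<open>Intended for finite \<open>I\<close> and \<open>d \<le> card I\<close> only; list positions are counted from 0.\<close>

definition Top :: "nat \<Rightarrow> 'i set \<Rightarrow> ('i \<Rightarrow> real) \<Rightarrow> real" where
  "Top d I a = (\<Sum>j<d. decr_rearrangement I a ! j)"

definition pos_semidef :: "real^'p^'p \<Rightarrow> bool" where
  "pos_semidef A \<longleftrightarrow> transpose A = A \<and> (\<forall>x. 0 \<le> x \<bullet> (A *v x))"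

definition charpoly :: "real^'p^'p \<Rightarrow> real poly" where
  "charpoly A = det (mat (monom 1 1) - map_matrix (\<lambda>a. [:a:]) A)"

text \<open>The real eigenvalues, repeated according to algebraic multiplicity, in non-increasing order.
  For symmetric \<open>A\<close> these are all eigenvalues, so the list has length \<open>CARD('p)\<close>.\<close>

definition eigvals :: "real^'p^'p \<Rightarrow> real list" where
  "eigvals A = rev (sorted_list_of_multiset (proots (charpoly A)))"

text \<open>The centered normal law on the line with \<^emph>\<open>variance\<close> \<open>s\<close>, a point mass if \<open>s = 0\<close>;
  \<^const>\<open>normal_density\<close> takes the standard deviation as its parameter.\<close>

definition centered_normal :: "real \<Rightarrow> real measure" where
  "centered_normal s =
     (if s = 0 then return borel 0 else density lborel (normal_density 0 (sqrt s)))"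

text \<open>\<open>g \<sim> N(0, \<Sigma>)\<close>, possibly degenerate: every linear functional \<open>u \<bullet> g\<close> is a centered normal
  variable with variance \<open>u \<bullet> \<Sigma>u\<close>.\<close>

definition gaussian_vector :: "'w measure \<Rightarrow> ('w \<Rightarrow> real^'p) \<Rightarrow> real^'p^'p \<Rightarrow> bool" where
  "gaussian_vector M g \<Sigma> \<longleftrightarrow>
     g \<in> borel_measurable M \<and>
     (\<forall>u. distr M borel (\<lambda>\<omega>. u \<bullet> g \<omega>) = centered_normal (u \<bullet> (\<Sigma> *v u)))"

text \<open>The covariance enters \<open>risk\<close> and \<open>OPT\<close> through the random vector \<open>g\<close>; both depend only on
  the law of \<open>g\<close>. The supremum is over a bounded set when \<open>g\<close> is Gaussian, since \<open>Top d\<close> of the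
  squared coordinates is at most the squared norm of \<open>g\<close>.\<close>

definition risk :: "nat \<Rightarrow> 'w measure \<Rightarrow> ('w \<Rightarrow> real^'p) \<Rightarrow> real^'p^'p \<Rightarrow> real" where
  "risk d M g V = (\<integral>\<omega>. Top d UNIV (\<lambda>i. (column i V \<bullet> g \<omega>)\<^sup>2) \<partial>M)"

definition OPT :: "nat \<Rightarrow> 'w measure \<Rightarrow> ('w \<Rightarrow> real^'p) \<Rightarrow> real" where
  "OPT d M g = (SUP V \<in> {V. orthogonal_matrix V}. risk d M g V)"

text \<open>The independent standard normal variables are the coordinates of the product space.\<close>

definition KL :: "nat \<Rightarrow> real^'p^'p \<Rightarrow> real" where
  "KL d \<Sigma> = (\<integral>z. Top d {..<CARD('p)} (\<lambda>j. eigvals \<Sigma> ! j * (z j)\<^sup>2)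
     \<partial>(\<Pi>\<^sub>M j\<in>{..<CARD('p)}. density lborel std_normal_density))"

definition c_const :: "nat \<Rightarrow> nat \<Rightarrow> real" where
  "c_const d r =
     1 - real (r choose d) * (real d / real r) ^ d * (1 - real d / real r) ^ (r + 1 - d)"

definition gamma_const :: "nat \<Rightarrow> real" where
  "gamma_const d = 1 - exp (- real d) * real d ^ d / fact d"

end

theory Submission
  imports Defs "HOL-Real_Asymp.Real_Asymp"
begin

text \<open>
  Both sides are compared with the ex-ante relaxation. Since \<open>Top d a \<le> d t + \<Sum>\<^sub>i max 0 (a\<^sub>i - t)\<close> for every
  \<open>t\<close>, and the variances of the coordinates in any orthonormal basis are a doubly stochastic average of
  the eigenvalues, convexity gives \<open>risk V \<le> d t + \<Sum>\<^sub>j E max 0 (\<lambda>\<^sub>j Z\<^sub>j\<^sup>2 - t)\<close> for every \<open>V\<close>. In an eigenbasis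
  the coordinates are independent and the risk equals \<open>KL\<close>. By the layer-cake formula
  \<open>KL = \<integral> E min(d, N\<^sub>s) ds\<close>, where \<open>N\<^sub>s\<close>, the number of the variables \<open>\<lambda>\<^sub>j Z\<^sub>j\<^sup>2\<close> exceeding \<open>s\<close>, is a
  sum of independent indicators, only \<open>r\<close> of which do not vanish. The correlation gap
  \<open>E min(d, N\<^sub>s) \<ge> c min(d, E N\<^sub>s)\<close> of the uniform matroid, integrated over \<open>s\<close>, yields \<open>c\<close> times the
  same upper bound when \<open>t\<close> is the level at which \<open>E N\<^sub>s\<close> crosses \<open>d\<close>.
\<close>

section \<open>Sums of independent Bernoulli variables\<close>

text \<open>In a general orthonormal basis the coordinates are dependent, so the upper bound may use
  only their marginal laws; the threshold bound, a sum of one-coordinate excesses, has exactly this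
  property. The lower bound needs the opposite, full independence, which comes from an eigenbasis.
  Since \<open>gaussian_vector\<close> prescribes only the laws of linear functionals, that
  independence has to be extracted from characteristic functions. The constant
  \<open>c_const d r\<close> is E min(d, N) / d for N binomial with r trials and mean d. This is the
  extremal case of the correlation gap: among r probabilities with given sum the equal ones are
  worst because min(d, k) is concave in k. \<open>gamma_const d\<close> is the same ratio for a
  Poisson variable with mean d, the limit for large r, so 1/sqrt(2 pi d) in the expansion is the
  asymptotic Poisson mass at its mean.\<close>

definition pois_binom :: "(nat \<Rightarrow> real) \<Rightarrow> ('i \<Rightarrow> real) \<Rightarrow> 'i set \<Rightarrow> real" where
  "pois_binom f p I = (\<Sum>S\<in>Pow I. (\<Prod>i\<in>S. p i) * (\<Prod>i\<in>I - S. 1 - p i) * f (card S))"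

lemma pois_binom_empty [simp]: "pois_binom f p {} = f 0"
  by (simp add: pois_binom_def)

text \<open>Conditioning on the variable with index \<open>i\<close>. A success shifts the argument
  of \<open>f\<close>, which is why inductions built on this recursion keep \<open>f\<close>
  arbitrary.\<close>

lemma pois_binom_insert:
  assumes "finite I" "i \<notin> I"
  shows "pois_binom f p (insert i I) =
    p i * pois_binom (\<lambda>k. f (Suc k)) p I + (1 - p i) * pois_binom f p I"
proof -
  let ?t = "\<lambda>S. (\<Prod>j\<in>S. p j) * (\<Prod>j\<in>insert i I - S. 1 - p j) * f (card S)"
  have inj: "inj_on (insert i) (Pow I)"
    using assms(2) by (auto simp: inj_on_def)
  have "pois_binom f p (insert i I) = (\<Sum>S\<in>Pow I. ?t S) + (\<Sum>S\<in>insert i ` Pow I. ?t S)"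
    unfolding pois_binom_def Pow_insert
    using assms by (intro sum.union_disjoint) auto
  also have "(\<Sum>S\<in>insert i ` Pow I. ?t S) = (\<Sum>S\<in>Pow I. ?t (insert i S))"
    using inj by (simp add: sum.reindex)
  also have "\<dots> = p i * pois_binom (\<lambda>k. f (Suc k)) p I"
    unfolding pois_binom_def sum_distrib_left
  proof (rule sum.cong)
    fix S assume "S \<in> Pow I"
    then have "finite S" "i \<notin> S" "insert i I - insert i S = I - S"
      using assms finite_subset by auto
    then show "?t (insert i S) = p i * ((\<Prod>j\<in>S. p j) * (\<Prod>j\<in>I - S. 1 - p j) * f (Suc (card S)))"
      by simp
  qed simp
  also have "(\<Sum>S\<in>Pow I. ?t S) = (1 - p i) * pois_binom f p I"
    unfolding pois_binom_def sum_distrib_left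
  proof (rule sum.cong)
    fix S assume "S \<in> Pow I"
    then have "insert i I - S = insert i (I - S)"
      using assms by auto
    then show "?t S = (1 - p i) * ((\<Prod>j\<in>S. p j) * (\<Prod>j\<in>I - S. 1 - p j) * f (card S))"
      using assms by simp
  qed simp
  finally show ?thesis by simp
qed

lemma pois_binom_cong:
  assumes "\<And>i. i \<in> I \<Longrightarrow> p i = q i"
  shows "pois_binom f p I = pois_binom f q I"
  unfolding pois_binom_def
proof (rule sum.cong)
  fix S assume "S \<in> Pow I"
  then have "(\<Prod>i\<in>S. p i) = (\<Prod>i\<in>S. q i)" "(\<Prod>i\<in>I - S. 1 - p i) = (\<Prod>i\<in>I - S. 1 - q i)"
    using assms by (auto intro!: prod.cong)
  then show "(\<Prod>i\<in>S. p i) * (\<Prod>i\<in>I - S. 1 - p i) * f (card S) =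
    (\<Prod>i\<in>S. q i) * (\<Prod>i\<in>I - S. 1 - q i) * f (card S)" by simp
qed simp

lemma pois_binom_mono_fun:
  assumes "\<And>i. i \<in> I \<Longrightarrow> 0 \<le> p i \<and> p i \<le> 1" "\<And>k. f k \<le> h k"
  shows "pois_binom f p I \<le> pois_binom h p I"
  unfolding pois_binom_def
  using assms by (intro sum_mono mult_left_mono mult_nonneg_nonneg prod_nonneg) auto

lemma pois_binom_linear:
  "pois_binom (\<lambda>k. a * f k + b * h k) p I = a * pois_binom f p I + b * pois_binom h p I"
  unfolding pois_binom_def
  by (simp add: sum_distrib_left sum.distrib[symmetric] algebra_simps)

text \<open>The expectation is affine in each success probability, with slope equal to the expected
  increment of \<open>f\<close>, nonnegative for monotone \<open>f\<close>.\<close>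

lemma pois_binom_mono_prob:
  assumes "finite I" "\<And>i. i \<in> I \<Longrightarrow> 0 \<le> p i \<and> p i \<le> q i \<and> q i \<le> 1" "mono f"
  shows "pois_binom f p I \<le> pois_binom f q I"
  using assms
proof (induction I arbitrary: f)
  case (insert i I)
  have le: "pois_binom f p I \<le> pois_binom f q I"
    "pois_binom (\<lambda>k. f (Suc k)) p I \<le> pois_binom (\<lambda>k. f (Suc k)) q I"
    using insert.prems by (auto intro!: insert.IH simp: mono_def)
  have "pois_binom f q I \<le> pois_binom (\<lambda>k. f (Suc k)) q I"
    using insert.prems by (intro pois_binom_mono_fun) (force simp: mono_def)+
  then have "p i * (pois_binom (\<lambda>k. f (Suc k)) q I - pois_binom f q I)
      \<le> q i * (pois_binom (\<lambda>k. f (Suc k)) q I - pois_binom f q I)"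
    using insert.prems by (intro mult_right_mono) auto
  moreover have "p i * pois_binom (\<lambda>k. f (Suc k)) p I \<le> p i * pois_binom (\<lambda>k. f (Suc k)) q I"
    "(1 - p i) * pois_binom f p I \<le> (1 - p i) * pois_binom f q I"
    using le insert.prems(1)[of i] by (auto intro!: mult_left_mono)
  ultimately show ?case
    using insert.hyps by (simp add: pois_binom_insert algebra_simps)
qed simp

text \<open>As a function of two probabilities the expectation depends only on their sum and
  product. The coefficient of the product is the expected second difference of \<open>f\<close>,
  nonpositive by concavity, so raising the product at fixed sum lowers the expectation.\<close>

lemma pois_binom_balance:
  fixes f :: "nat \<Rightarrow> real"
  assumes "finite I" "i \<notin> I" "j \<notin> I" "i \<noteq> j"
    and "\<And>k. f (Suc (Suc k)) + f k \<le> 2 * f (Suc k)"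
    and "\<And>k. k \<in> I \<Longrightarrow> 0 \<le> p k \<and> p k \<le> 1"
    and "\<And>k. k \<in> I \<Longrightarrow> q k = p k"
    and "q i + q j = p i + p j" "p i * p j \<le> q i * q j"
  shows "pois_binom f q (insert i (insert j I)) \<le> pois_binom f p (insert i (insert j I))"
proof -
  let ?F = "\<lambda>h. pois_binom h p I"
  let ?f1 = "\<lambda>k. f (Suc k)" and ?f2 = "\<lambda>k. f (Suc (Suc k))"
  have expand: "pois_binom f u (insert i (insert j I)) =
      ?F f + (u i + u j) * (?F ?f1 - ?F f) + u i * u j * (?F ?f2 + ?F f - 2 * ?F ?f1)"
    if "\<And>k. k \<in> I \<Longrightarrow> u k = p k" for u
  proof -
    have eq: "pois_binom h u I = ?F h" for h
      using that by (intro pois_binom_cong) auto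
    show ?thesis
      using assms(1-4) by (simp add: pois_binom_insert eq algebra_simps)
  qed
  have "?F (\<lambda>k. 1 * ?f2 k + 1 * f k) \<le> ?F (\<lambda>k. 2 * ?f1 k + 0 * f k)"
    using assms(5,6) by (intro pois_binom_mono_fun) auto
  then have "?F ?f2 + ?F f - 2 * ?F ?f1 \<le> 0"
    unfolding pois_binom_linear by simp
  then have "q i * q j * (?F ?f2 + ?F f - 2 * ?F ?f1) \<le> p i * p j * (?F ?f2 + ?F f - 2 * ?F ?f1)"
    using assms(9) by (intro mult_right_mono_neg)
  then show ?thesis
    using expand[of p] expand[of q] assms(7,8) by simp
qed

text \<open>Hoeffding's theorem. Moving two success probabilities on opposite sides of the mean towards
  each other until one of them hits the mean increases their product and therefore, by concavity,
  decreases the expectation; finitely many such moves suffice.\<close>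

lemma pois_binom_concave_ge_equal:
  fixes f :: "nat \<Rightarrow> real"
  assumes "finite I" and conc: "\<And>k. f (Suc (Suc k)) + f k \<le> 2 * f (Suc k)"
    and "\<And>i. i \<in> I \<Longrightarrow> 0 \<le> p i \<and> p i \<le> 1"
    and "(\<Sum>i\<in>I. p i) = real (card I) * \<mu>"
  shows "pois_binom f (\<lambda>_. \<mu>) I \<le> pois_binom f p I"
  using assms(3,4)
proof (induction "card {i\<in>I. p i \<noteq> \<mu>}" arbitrary: p rule: less_induct)
  case (less p)
  show ?case
  proof (cases "\<forall>i\<in>I. p i = \<mu>")
    case True
    then show ?thesis using pois_binom_cong[of I p "\<lambda>_. \<mu>" f] by simp
  next
    case False
    have sum0: "(\<Sum>i\<in>I. p i - \<mu>) = 0"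
      unfolding sum_subtractf using less.prems(2) by simp
    obtain i where i: "i \<in> I" "p i < \<mu>"
      using False sum0 sum_nonneg_eq_0_iff[OF \<open>finite I\<close>, of "\<lambda>i. p i - \<mu>"] by force
    obtain j where j: "j \<in> I" "\<mu> < p j"
      using False sum0 sum_nonneg_eq_0_iff[OF \<open>finite I\<close>, of "\<lambda>i. \<mu> - p i"]
      by (force simp: sum_subtractf)
    have "i \<noteq> j" using i j by auto
    \<comment> \<open>Index \<open>i\<close> lands exactly on the mean and \<open>j\<close> absorbs
      the difference, so the number of indices off the mean, the induction measure, drops. The new
      value at \<open>j\<close> lies between \<open>p i\<close> and \<open>p j\<close>, hence in
      [0, 1].\<close>
    define q where "q = p(i := \<mu>, j := p i + p j - \<mu>)"
    define I' where "I' = I - {i, j}"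
    have I: "I = insert i (insert j I')" "finite I'" "i \<notin> I'" "j \<notin> I'"
      using i j \<open>finite I\<close> by (auto simp: I'_def)
    have q: "q i = \<mu>" "q j = p i + p j - \<mu>" "\<And>k. k \<in> I' \<Longrightarrow> q k = p k"
      using \<open>i \<noteq> j\<close> by (auto simp: q_def I'_def)
    have "0 \<le> (\<mu> - p i) * (p j - \<mu>)"
      using i j by simp
    then have prod: "p i * p j \<le> q i * q j"
      by (simp add: q algebra_simps)
    have "{k\<in>I. q k \<noteq> \<mu>} \<subset> {k\<in>I. p k \<noteq> \<mu>}"
    proof
      show "{k\<in>I. q k \<noteq> \<mu>} \<subseteq> {k\<in>I. p k \<noteq> \<mu>}"
        using i j by (auto simp: q_def split: if_splits)
      show "{k\<in>I. q k \<noteq> \<mu>} \<noteq> {k\<in>I. p k \<noteq> \<mu>}"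
      proof -
        have "i \<in> {k\<in>I. p k \<noteq> \<mu>}" "i \<notin> {k\<in>I. q k \<noteq> \<mu>}"
          using i q(1) by simp_all
        then show ?thesis by metis
      qed
    qed
    then have "card {k\<in>I. q k \<noteq> \<mu>} < card {k\<in>I. p k \<noteq> \<mu>}"
      using \<open>finite I\<close> by (intro psubset_card_mono) auto
    moreover have "0 \<le> q k \<and> q k \<le> 1" if "k \<in> I" for k
      using less.prems(1)[OF that] less.prems(1)[OF i(1)] less.prems(1)[OF j(1)] i j
      by (auto simp: q_def)
    moreover have "(\<Sum>i\<in>I. q i) = card I * \<mu>"
    proof -
      have "(\<Sum>k\<in>I. q k) = (\<Sum>k\<in>I. p k)"
        using I(2-4) \<open>i \<noteq> j\<close> q unfolding I(1) by simp
      then show ?thesis using less.prems(2) by simp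
    qed
    ultimately have "pois_binom f (\<lambda>_. \<mu>) I \<le> pois_binom f q I"
      by (rule less.hyps)
    also have "\<dots> \<le> pois_binom f p I"
      unfolding I(1) using I \<open>i \<noteq> j\<close> conc less.prems(1) prod q
      by (intro pois_binom_balance) auto
    finally show ?thesis .
  qed
qed

section \<open>Binomial sums and the correlation gap\<close>

lemma pois_binom_const:
  assumes "finite I"
  shows "pois_binom f (\<lambda>_. q) I =
    (\<Sum>k\<le>card I. real (card I choose k) * q ^ k * (1 - q) ^ (card I - k) * f k)"
proof -
  let ?g = "\<lambda>k. q ^ k * (1 - q) ^ (card I - k) * f k"
  have "pois_binom f (\<lambda>_. q) I = (\<Sum>S\<in>Pow I. ?g (card S))"
    unfolding pois_binom_def using assms
    by (intro sum.cong) (auto simp: card_Diff_subset finite_subset)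
  also have "\<dots> = (\<Sum>k\<le>card I. \<Sum>S\<in>{S \<in> Pow I. card S = k}. ?g (card S))"
    using assms by (intro sum.group[symmetric]) (auto simp: card_mono)
  also have "\<dots> = (\<Sum>k\<le>card I. real (card I choose k) * ?g k)"
  proof (rule sum.cong)
    fix k
    have "(\<Sum>S\<in>{S \<in> Pow I. card S = k}. ?g (card S)) = (\<Sum>S\<in>{S. S \<subseteq> I \<and> card S = k}. ?g k)"
      by (intro sum.cong) auto
    then show "(\<Sum>S\<in>{S \<in> Pow I. card S = k}. ?g (card S)) = real (card I choose k) * ?g k"
      using n_subsets[OF assms, of k] by simp
  qed simp
  finally show ?thesis by (simp add: mult.assoc)
qed

text \<open>The sum telescopes: adding the term with index d turns the factor d (1 - q) into (n - d)
  q, and (n - d) q b(d) = (d + 1) (1 - q) b(d + 1) for the binomial weights b.\<close>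

lemma de_moivre_binomial_partial_sum:
  assumes "d \<le> n"
  shows "(\<Sum>k<d. (real n * q - real k) * (real (n choose k) * q ^ k * (1 - q) ^ (n - k))) =
    real d * (1 - q) * (real (n choose d) * q ^ d * (1 - q) ^ (n - d))"
  using assms
proof (induction d)
  case (Suc d)
  have bin: "real (Suc d) * real (n choose Suc d) = real (n - d) * real (n choose d)"
    by (metis Suc.prems binomial_absorb_comp Suc_times_binomial_eq binomial_absorption
        diff_Suc_1 of_nat_mult mult.commute Suc_le_D)
  have pow: "(1 - q) ^ (n - d) = (1 - q) * (1 - q) ^ (n - Suc d)"
    using Suc.prems by (metis Suc_diff_Suc Suc_le_lessD power_Suc)
  have nd: "real (n - d) = real n - real d" using Suc.prems by simp
  let ?c = "real (n choose d) * q ^ d * (1 - q) ^ (n - d)"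
  have "(\<Sum>k<Suc d. (real n * q - real k) * (real (n choose k) * q ^ k * (1 - q) ^ (n - k)))
      = (real d * (1 - q) + (real n * q - real d)) * ?c"
    using Suc by (simp add: algebra_simps)
  also have "\<dots> = real (n - d) * real (n choose d) * (q * q ^ d * (1 - q) ^ (n - d))"
    by (simp add: nd algebra_simps)
  also have "\<dots> = real (Suc d) * (1 - q) * (real (n choose Suc d) * q ^ Suc d * (1 - q) ^ (n - Suc d))"
    unfolding bin[symmetric] pow by (simp add: algebra_simps)
  finally show ?case .
qed simp

text \<open>The origin of \<open>c_const\<close>. For binomial N with mean d, the shortfall E max(0,
  d - N) is De Moivre's sum. Its extra factor 1 - q raises the exponent n - d of the weight at d to
  n + 1 - d.\<close>

lemma pois_binom_min_critical:
  assumes "finite I" "0 < d" "d \<le> card I"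
  shows "pois_binom (\<lambda>k. min (real d) (real k)) (\<lambda>_. real d / real (card I)) I =
    real d * c_const d (card I)"
proof -
  define n where "n = card I"
  define q where "q = real d / real n"
  have nq: "real n * q = real d" and "d \<le> n" using assms by (auto simp: q_def n_def)
  let ?b = "\<lambda>k. real (n choose k) * q ^ k * (1 - q) ^ (n - k)"
  have total: "(\<Sum>k\<le>n. ?b k) = 1"
    using binomial_ring[of q "1 - q" n] by (simp add: mult.assoc)
  have "real d - (\<Sum>k\<le>n. ?b k * min (real d) (real k)) =
      (\<Sum>k\<le>n. ?b k * (real d - min (real d) (real k)))"
    by (simp add: sum_subtractf right_diff_distrib sum_distrib_right[symmetric] total)
  also have "\<dots> = (\<Sum>k<d. ?b k * (real d - min (real d) (real k)))"
    using \<open>d \<le> n\<close> by (intro sum.mono_neutral_right) auto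
  also have "\<dots> = (\<Sum>k<d. (real n * q - real k) * ?b k)"
    by (intro sum.cong) (auto simp: nq)
  also have "\<dots> = real d * (1 - q) * ?b d"
    by (rule de_moivre_binomial_partial_sum) fact
  also have "\<dots> = real d * (1 - c_const d n)"
    using \<open>d \<le> n\<close> by (simp add: c_const_def q_def Suc_diff_le)
  finally show ?thesis
    unfolding pois_binom_const[OF assms(1)] n_def[symmetric] q_def[symmetric]
    by (simp add: algebra_simps)
qed

text \<open>Size biasing: weighting a binomial variable by its own value yields one plus a binomial
  variable with one trial fewer.\<close>

lemma pois_binom_const_absorb:
  assumes "finite I" "i \<notin> I"
  shows "pois_binom (\<lambda>k. real k * h k) (\<lambda>_. q) (insert i I) =
    real (Suc (card I)) * q * pois_binom (\<lambda>k. h (Suc k)) (\<lambda>_. q) I"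
proof -
  define n where "n = card I"
  have "pois_binom (\<lambda>k. real k * h k) (\<lambda>_. q) (insert i I) =
     (\<Sum>k\<le>n. real (Suc n choose Suc k) * q ^ Suc k * (1 - q) ^ (n - k) * (real (Suc k) * h (Suc k)))"
    using assms by (simp add: pois_binom_const n_def sum.atMost_Suc_shift del: sum.atMost_Suc)
  also have "\<dots> = (\<Sum>k\<le>n. real (Suc n) * q * (real (n choose k) * q ^ k * (1 - q) ^ (n - k) * h (Suc k)))"
  proof (rule sum.cong)
    fix k
    have "real (Suc k) * real (Suc n choose Suc k) = real (Suc n) * real (n choose k)"
      by (metis Suc_times_binomial of_nat_mult)
    then have "(real (Suc k) * real (Suc n choose Suc k)) * (q * q ^ k * (1 - q) ^ (n - k) * h (Suc k)) =
      (real (Suc n) * real (n choose k)) * (q * q ^ k * (1 - q) ^ (n - k) * h (Suc k))" by (simp only:)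
    then show "real (Suc n choose Suc k) * q ^ Suc k * (1 - q) ^ (n - k) * (real (Suc k) * h (Suc k)) =
      real (Suc n) * q * (real (n choose k) * q ^ k * (1 - q) ^ (n - k) * h (Suc k))"
      unfolding power_Suc by (simp only: mult_ac)
  qed simp
  also have "\<dots> = real (Suc (card I)) * q * pois_binom (\<lambda>k. h (Suc k)) (\<lambda>_. q) I"
    using assms by (simp add: pois_binom_const n_def sum_distrib_left)
  finally show ?thesis .
qed

text \<open>The correlation gap of the uniform matroid of rank \<open>d\<close>. By absorption, \<open>E min(d, N) / q\<close> is,
  for \<open>N\<close> binomial, the expectation of a decreasing function of a binomial variable, so it
  decreases in \<open>q\<close>; hence the mean \<open>d\<close> is the worst case.\<close>

lemma pois_binom_min_ge:
  assumes "finite I" "0 < d" "d \<le> card I" "\<And>i. i \<in> I \<Longrightarrow> 0 \<le> p i \<and> p i \<le> 1"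
  shows "c_const d (card I) * min (real d) (\<Sum>i\<in>I. p i) \<le> pois_binom (\<lambda>k. min (real d) (real k)) p I"
proof -
  let ?n = "real (card I)" and ?f = "\<lambda>k. min (real d) (real k)"
  define \<mu> where "\<mu> = (\<Sum>i\<in>I. p i) / ?n"
  have n: "?n > 0" using assms by simp
  have \<mu>: "(\<Sum>i\<in>I. p i) = ?n * \<mu>" using n by (simp add: \<mu>_def)
  have "0 \<le> (\<Sum>i\<in>I. p i)" "(\<Sum>i\<in>I. p i) \<le> ?n"
    using assms(4) sum_bounded_above[of I p 1] by (auto intro: sum_nonneg)
  then have \<mu>01: "0 \<le> \<mu>" "\<mu> \<le> 1" using n by (auto simp: \<mu>_def)
  let ?q = "real d / ?n"
  have q01: "0 < ?q" "?q \<le> 1" using assms by auto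
  have crit: "pois_binom ?f (\<lambda>_. ?q) I = real d * c_const d (card I)"
    using assms by (intro pois_binom_min_critical)
  have "c_const d (card I) * min (real d) (?n * \<mu>) \<le> pois_binom ?f (\<lambda>_. \<mu>) I"
  \<comment> \<open>From \<open>?q\<close> upwards the minimum on the left is capped at d, so
    monotonicity in the probability reduces the claim to the critical case.\<close>
  proof (cases "?q \<le> \<mu>")
    case True
    then have "real d \<le> ?n * \<mu>" using n by (simp add: field_simps)
    moreover have "pois_binom ?f (\<lambda>_. ?q) I \<le> pois_binom ?f (\<lambda>_. \<mu>) I"
      using assms(1) True q01 \<mu>01 by (intro pois_binom_mono_prob) (auto simp: mono_def)
    ultimately show ?thesis using crit by (simp add: mult.commute)
  next
    case False
    obtain i where "i \<in> I" using assms by fastforce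
    define J where "J = I - {i}"
    have J: "I = insert i J" "finite J" "i \<notin> J"
      using \<open>i \<in> I\<close> assms(1) by (auto simp: J_def)
    then have cJ: "Suc (card J) = card I" by simp
    \<comment> \<open>\<open>h 0 = 0\<close> because division by zero gives 0, so only the shifted
      function \<open>h (Suc k)\<close> is decreasing. That suffices: the value at 0 is multiplied
      by 0, and absorption leaves the shifted function.\<close>
    define h where "h k = min 1 (real d / real k)" for k
    have f: "?f = (\<lambda>k. real k * h k)"
      by (auto simp: h_def fun_eq_iff min_def field_simps)
    have fac: "pois_binom ?f (\<lambda>_. x) I = ?n * x * pois_binom (\<lambda>k. h (Suc k)) (\<lambda>_. x) J" for x
      unfolding f using pois_binom_const_absorb[OF J(2,3), of h x] J(1) cJ by simp
    have anti: "h (Suc k) \<ge> h (Suc l)" if "k \<le> l" for k l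
      using that by (auto simp: h_def min_le_iff_disj intro!: divide_left_mono)
    have "pois_binom (\<lambda>k. - h (Suc k)) (\<lambda>_. \<mu>) J \<le> pois_binom (\<lambda>k. - h (Suc k)) (\<lambda>_. ?q) J"
      using J \<mu>01 False q01 anti by (intro pois_binom_mono_prob) (auto simp: mono_def)
    moreover have "pois_binom (\<lambda>k. - h (Suc k)) (\<lambda>_. x) J = - pois_binom (\<lambda>k. h (Suc k)) (\<lambda>_. x) J" for x
      using pois_binom_linear[of "-1" "\<lambda>k. h (Suc k)" 0 "\<lambda>_. 0" "\<lambda>_. x" J] by simp
    ultimately have "pois_binom (\<lambda>k. h (Suc k)) (\<lambda>_. ?q) J \<le> pois_binom (\<lambda>k. h (Suc k)) (\<lambda>_. \<mu>) J"
      by simp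
    moreover have "pois_binom (\<lambda>k. h (Suc k)) (\<lambda>_. ?q) J = c_const d (card I)"
      using fac[of ?q] crit n assms(2) by simp
    ultimately have "?n * \<mu> * c_const d (card I) \<le> pois_binom ?f (\<lambda>_. \<mu>) I"
      unfolding fac using n \<mu>01 by (intro mult_left_mono) auto
    moreover have "?n * \<mu> \<le> real d" using False n by (simp add: field_simps)
    ultimately show ?thesis by (simp add: mult.commute)
  qed
  also have "\<dots> \<le> pois_binom ?f p I"
    using assms \<mu> by (intro pois_binom_concave_ge_equal) (auto simp: min_def)
  finally show ?thesis unfolding \<mu> .
qed

section \<open>The constants\<close>

text \<open>Put n = r - d. Since 1 - (d + 1)/r = (1 - d/r) (1 - 1/n), and the product gains one
  factor 1 - d/r, passing from d to d + 1 multiplies the left side by (1 - 1/n)^n, which is at most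
  exp(-1).\<close>

lemma binomial_weight_le_exp:
  assumes "d < r"
  shows "(\<Prod>i<d. 1 - real i / real r) * (1 - real d / real r) ^ (r + 1 - d) \<le> exp (- real d)"
  using assms
proof (induction d)
  case 0
  then show ?case by simp
next
  case (Suc d)
  define n where "n = r - d"
  have n: "1 < n" "r = d + n" using Suc.prems by (auto simp: n_def)
  have "(1 - 1 / real n) ^ n \<le> exp (- 1 / real n) ^ n"
    using n exp_ge_add_one_self[of "- 1 / real n"] by (intro power_mono) auto
  also have "\<dots> = exp (- 1)" using n by (simp add: exp_of_nat_mult[symmetric])
  finally have e: "(1 - 1 / real n) ^ n \<le> exp (- 1)" .
  let ?P = "\<Prod>i<d. 1 - real i / real r"
  have "?P \<ge> 0" using Suc.prems by (intro prod_nonneg) (auto simp: field_simps)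
  have q: "1 - real (Suc d) / real r = (1 - real d / real r) * (1 - 1 / real n)"
  proof -
    have "1 - real (Suc d) / real r = (real n - 1) / real r" "1 - real d / real r = real n / real r"
      using n by (auto simp: field_simps)
    moreover have "real n / real r * (1 - 1 / real n) = (real n - 1) / real r"
    proof -
      have "real n * (1 - 1 / real n) = real n - 1" using n(1) by (simp add: right_diff_distrib)
      then show ?thesis by (metis times_divide_eq_left)
    qed
    ultimately show ?thesis by (simp only:)
  qed
  have "(\<Prod>i<Suc d. 1 - real i / real r) * (1 - real (Suc d) / real r) ^ (r + 1 - Suc d) =
      (?P * (1 - real d / real r) ^ (r + 1 - d)) * (1 - 1 / real n) ^ n"
    unfolding q using n by (simp add: power_mult_distrib)
  also have "\<dots> \<le> exp (- real d) * exp (- 1)"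
    using Suc e n \<open>?P \<ge> 0\<close> by (intro mult_mono) (auto simp: field_simps)
  also have "\<dots> = exp (- real (Suc d))" by (simp add: exp_add[symmetric])
  finally show ?case .
qed

text \<open>\<open>1 - c_const d r\<close> is the binomial weight at its mean times 1 - d/r, and
  \<open>1 - gamma_const d\<close> is the Poisson weight at its mean. The factor 1 - d/r matters:
  for d = 1 and r = 2 the binomial weight alone is 1/2 and exceeds exp(-1).\<close>

lemma gamma_const_le_c_const:
  assumes "d < r"
  shows "gamma_const d \<le> c_const d r"
proof -
  have "real (r choose d) = (\<Prod>i<d. real r - real i) / fact d"
    by (simp add: binomial_gbinomial gbinomial_prod_rev atLeast0LessThan)
  also have "(\<Prod>i<d. real r - real i) = (\<Prod>i<d. real r * (1 - real i / real r))"
    using assms by (intro prod.cong) (auto simp: field_simps)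
  also have "\<dots> = real r ^ d * (\<Prod>i<d. 1 - real i / real r)"
    by (simp add: prod.distrib)
  finally have "real (r choose d) * (real d / real r) ^ d =
      real d ^ d / fact d * (\<Prod>i<d. 1 - real i / real r)"
    using assms by (simp add: power_divide)
  then have "real (r choose d) * (real d / real r) ^ d * (1 - real d / real r) ^ (r + 1 - d) =
      real d ^ d / fact d * ((\<Prod>i<d. 1 - real i / real r) * (1 - real d / real r) ^ (r + 1 - d))"
    by simp
  also have "\<dots> \<le> real d ^ d / fact d * exp (- real d)"
    using binomial_weight_le_exp[OF assms] by (intro mult_left_mono) auto
  finally show ?thesis by (simp add: c_const_def gamma_const_def mult.commute)
qed

section \<open>Stirling's formula with an explicit error\<close>

definition stirling_ln :: "nat \<Rightarrow> real" where
  "stirling_ln n = ln (fact n) - (real n + 1 / 2) * ln (real n) + real n"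

text \<open>The logarithm in the step is the integral of 1/x over [n, n + 1]. By convexity the
  midpoint rule bounds it below and the trapezoidal rule above; the trapezoidal error telescopes and
  later becomes the error term 1/(4 n).\<close>

lemma stirling_ln_step:
  assumes "0 < n"
  shows "stirling_ln (Suc n) \<le> stirling_ln n"
    and "stirling_ln n - stirling_ln (Suc n) \<le> 1 / (4 * real n) - 1 / (4 * real (Suc n))"
proof -
  let ?l = "ln (real n + 1) - ln (real n)"
  have "ln (fact (Suc n)) = ln (real n + 1) + ln (fact n)"
    by (simp only: fact_Suc of_nat_mult) (simp add: ln_mult add.commute)
  then have diff: "stirling_ln n - stirling_ln (Suc n) = (real n + 1 / 2) * ?l - 1"
    by (simp add: stirling_ln_def algebra_simps del: fact_Suc)
  have "2 / (real n + (real n + 1)) \<le> ?l"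
    using ln_inverse_approx_ge[of "real n" "real n + 1"] assms by simp
  then have "(real n + 1 / 2) * (2 / (real n + (real n + 1))) \<le> (real n + 1 / 2) * ?l"
    by (intro mult_left_mono) auto
  moreover have "(real n + 1 / 2) * (2 / (real n + (real n + 1))) = 1"
    by (simp add: divide_simps)
  ultimately show "stirling_ln (Suc n) \<le> stirling_ln n"
    using diff by linarith
  have "?l \<le> (inverse (real n) + inverse (real n + 1)) / 2"
    using ln_inverse_approx_le[of "real n" 1] assms by simp
  then have "(real n + 1 / 2) * ?l \<le> (real n + 1 / 2) * ((inverse (real n) + inverse (real n + 1)) / 2)"
    by (intro mult_left_mono) auto
  also have "\<dots> = 1 + (1 / (4 * real n) - 1 / (4 * real (Suc n)))"
    using assms by (simp add: divide_simps) (simp add: algebra_simps)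
  finally show "stirling_ln n - stirling_ln (Suc n) \<le> 1 / (4 * real n) - 1 / (4 * real (Suc n))"
    using diff by simp
qed

text \<open>Expresses the Wallis products through n! and (2 n)!, so that their limit fixes the
  constant in Stirling's formula.\<close>

lemma wallis_product_fact:
  "(\<Prod>k=1..n. (4 * real k ^ 2) / (4 * real k ^ 2 - 1)) =
    (2 ^ n * fact n) ^ 4 / ((fact (2 * n))\<^sup>2 * (2 * real n + 1))"
proof (induction n)
  case (Suc n)
  have pos: "(1 + real n) * (1 + real n) * 4 - 1 = (2 * real n + 1) * (2 * real n + 3)"
    by (simp add: algebra_simps)
  have step: "A ^ 4 / (B\<^sup>2 * u) * (4 * y\<^sup>2 / (u * v)) = (A * (2 * y)) ^ 4 / ((2 * y * u * B)\<^sup>2 * v)"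
    if "y \<noteq> 0" "u \<noteq> 0" "v \<noteq> 0" "B \<noteq> 0" for A B y u v :: real
    using that by (simp add: divide_simps power_mult_distrib) (simp add: power2_eq_square power4_eq_xxxx)
  have f: "fact (2 * Suc n) = (2 * real n + 2) * (2 * real n + 1) * fact (2 * n)"
    by (simp add: algebra_simps)
  have "(\<Prod>k=1..Suc n. (4 * real k ^ 2) / (4 * real k ^ 2 - 1)) =
    (2 ^ n * fact n) ^ 4 / ((fact (2 * n))\<^sup>2 * (2 * real n + 1)) *
      ((4 * (real n + 1)\<^sup>2) / ((2 * real n + 1) * (2 * real n + 3)))"
    using Suc by (simp add: power2_eq_square pos[symmetric] algebra_simps)
  also have "\<dots> = (2 ^ n * fact n * (2 * (real n + 1))) ^ 4 /
      ((2 * (real n + 1) * (2 * real n + 1) * fact (2 * n))\<^sup>2 * (2 * real n + 3))"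
    by (rule step) auto
  also have "\<dots> = (2 ^ Suc n * fact (Suc n)) ^ 4 / ((fact (2 * Suc n))\<^sup>2 * (2 * real (Suc n) + 1))"
    unfolding f by (simp add: algebra_simps)
  finally show ?case .
qed simp

text \<open>\<open>stirling_ln\<close> decreases and, less 1/(4 n), increases, so both sequences
  converge to a common limit lying between them. Wallis' product then identifies this limit.\<close>

lemma stirling_ln_bounds:
  "0 < n \<Longrightarrow> ln (2 * pi) / 2 \<le> stirling_ln n"
  "0 < n \<Longrightarrow> stirling_ln n \<le> ln (2 * pi) / 2 + 1 / (4 * real n)"
proof -
  define L where "L n = stirling_ln (Suc n)" for n
  define K where "K n = stirling_ln (Suc n) - 1 / (4 * real (Suc n))" for n
  have dec: "decseq L"
    unfolding decseq_Suc_iff L_def using stirling_ln_step(1) by blast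
  have inc: "incseq K"
  proof (rule incseq_SucI)
    fix n show "K n \<le> K (Suc n)"
      using stirling_ln_step(2)[of "Suc n"] unfolding K_def by linarith
  qed
  have "K 0 \<le> L n" for n
  proof -
    have "K 0 \<le> K n" using inc by (simp add: incseq_def)
    also have "\<dots> \<le> L n" by (simp add: K_def L_def)
    finally show ?thesis .
  qed
  then obtain l where l: "L \<longlonglongrightarrow> l"
    using decseq_convergent[OF dec] by blast
  have "(\<lambda>n. L n - 1 / (4 * real (Suc n))) \<longlonglongrightarrow> l - 0"
    by (intro tendsto_diff l) real_asymp
  then have K: "K \<longlonglongrightarrow> l" by (simp add: K_def[abs_def] L_def)
  have lim: "stirling_ln \<longlonglongrightarrow> l"
    using l unfolding L_def by (rule LIMSEQ_imp_Suc)
  have lb: "l \<le> stirling_ln n" "stirling_ln n \<le> l + 1 / (4 * real n)" if "0 < n" for n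
  proof -
    obtain m where m: "n = Suc m" using \<open>0 < n\<close> gr0_implies_Suc by blast
    show "l \<le> stirling_ln n"
      using decseq_ge[OF dec l, of m] by (simp add: L_def m)
    show "stirling_ln n \<le> l + 1 / (4 * real n)"
      using incseq_le[OF inc K, of m] by (simp add: K_def m)
  qed
  have lim2: "(\<lambda>n. stirling_ln (2 * n)) \<longlonglongrightarrow> l"
    using lim by (rule LIMSEQ_subseq_LIMSEQ[unfolded o_def]) (simp add: strict_mono_def)
  \<comment> \<open>Chosen so that the normalizing terms of \<open>stirling_ln\<close> cancel and
    the logarithm of the Wallis product remains.\<close>
  have "(\<lambda>n. 4 * stirling_ln n - 2 * stirling_ln (2 * n) + (ln (real n) - ln (2 * real n + 1)) - ln 2)
      \<longlonglongrightarrow> 4 * l - 2 * l + (- ln 2) - ln 2"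
    by (intro tendsto_intros lim lim2) real_asymp
  moreover have "\<forall>\<^sub>F n in sequentially.
    4 * stirling_ln n - 2 * stirling_ln (2 * n) + (ln (real n) - ln (2 * real n + 1)) - ln 2 =
    ln (\<Prod>k=1..n. (4 * real k ^ 2) / (4 * real k ^ 2 - 1))"
    using eventually_gt_at_top[of 0]
  proof eventually_elim
    case (elim n)
    have "ln (\<Prod>k=1..n. (4 * real k ^ 2) / (4 * real k ^ 2 - 1)) =
      4 * (real n * ln 2 + ln (fact n)) - (2 * ln (fact (2 * n)) + ln (2 * real n + 1))"
      unfolding wallis_product_fact
      by (subst ln_div) (auto simp: ln_mult ln_realpow add_pos_pos)
    then show ?case
      using elim by (simp add: stirling_ln_def ln_mult algebra_simps)
  qed
  ultimately have "(\<lambda>n. ln (\<Prod>k=1..n. (4 * real k ^ 2) / (4 * real k ^ 2 - 1)))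
      \<longlonglongrightarrow> 4 * l - 2 * l + (- ln 2) - ln 2"
    by (rule Lim_transform_eventually)
  moreover have "(\<lambda>n. ln (\<Prod>k=1..n. (4 * real k ^ 2) / (4 * real k ^ 2 - 1))) \<longlonglongrightarrow> ln (pi / 2)"
    using wallis by (rule tendsto_ln) simp
  ultimately have "4 * l - 2 * l + (- ln 2) - ln 2 = ln (pi / 2)"
    by (rule LIMSEQ_unique)
  then have "ln (2 * pi) / 2 = l" by (simp add: ln_mult ln_div)
  then show "0 < n \<Longrightarrow> ln (2 * pi) / 2 \<le> stirling_ln n"
    "0 < n \<Longrightarrow> stirling_ln n \<le> ln (2 * pi) / 2 + 1 / (4 * real n)"
    using lb[of n] by simp_all
qed

section \<open>Expansion of the inverse of \<open>gamma_const\<close>\<close>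

lemma one_minus_gamma_const_eq:
  assumes "0 < n"
  shows "1 - gamma_const n = exp (ln (2 * pi) / 2 - stirling_ln n) / sqrt (2 * pi * real n)"
proof -
  have "1 - gamma_const n = exp (- real n + real n * ln (real n) - ln (fact n))"
    using assms by (simp add: gamma_const_def exp_add exp_diff exp_of_nat_mult exp_minus field_simps)
  also have "- real n + real n * ln (real n) - ln (fact n) =
      ln (2 * pi) / 2 - stirling_ln n - ln (2 * pi * real n) / 2"
    using assms by (simp add: stirling_ln_def ln_mult algebra_simps add_divide_distrib)
  also have "exp \<dots> = exp (ln (2 * pi) / 2 - stirling_ln n) / exp (ln (2 * pi * real n) / 2)"
    by (simp add: exp_diff)
  also have "exp (ln (2 * pi * real n) / 2) = sqrt (2 * pi * real n)"
    using assms by (simp add: ln_sqrt[symmetric])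
  finally show ?thesis .
qed

text \<open>The Poisson weight is 1/sqrt(2 pi n) times an exponential that Stirling's bounds keep
  between 1 - 1/(4 n) and 1. The bound 1/2, from 2 pi n >= 4, keeps \<open>gamma_const\<close> away
  from 0.\<close>

lemma one_minus_gamma_const_bounds:
  assumes "0 < n"
  shows "1 / sqrt (2 * pi * real n) - 1 / real n \<le> 1 - gamma_const n"
    and "1 - gamma_const n \<le> 1 / sqrt (2 * pi * real n)"
    and "0 \<le> 1 - gamma_const n"
    and "1 - gamma_const n \<le> 1 / 2"
proof -
  let ?s = "1 / sqrt (2 * pi * real n)"
  have "4 \<le> 2 * pi * real n"
    using mult_mono[of 4 "2 * pi" 1 "real n"] pi_ge_two assms by simp
  then have "2 \<le> sqrt (2 * pi * real n)"
    by (intro real_le_rsqrt) simp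
  then have s: "0 < ?s" "?s \<le> 1 / 2"
    using divide_left_mono[of 2 "sqrt (2 * pi * real n)" 1] assms by auto
  let ?e = "exp (ln (2 * pi) / 2 - stirling_ln n)"
  have eq: "1 - gamma_const n = ?s * ?e"
    using one_minus_gamma_const_eq[OF assms] by simp
  show "0 \<le> 1 - gamma_const n" unfolding eq using s by simp
  have "?e \<le> 1" using stirling_ln_bounds(1)[OF assms] by simp
  then show le: "1 - gamma_const n \<le> ?s"
    unfolding eq using s mult_left_mono[of ?e 1 ?s] by simp
  show "1 - gamma_const n \<le> 1 / 2" using le s by linarith
  have "1 - 1 / (4 * real n) \<le> ?e"
    using stirling_ln_bounds(2)[OF assms] exp_ge_add_one_self[of "ln (2 * pi) / 2 - stirling_ln n"]
    by linarith
  then have "?s * (1 - 1 / (4 * real n)) \<le> ?s * ?e"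
    using s by (intro mult_left_mono) auto
  moreover have "?s * (1 / (4 * real n)) \<le> 1 / 2 * (1 / (4 * real n))"
    using s by (intro mult_right_mono) auto
  moreover have "1 / 2 * (1 / (4 * real n)) \<le> 1 / real n"
    using assms by (simp add: field_simps)
  ultimately show "?s - 1 / real n \<le> 1 - gamma_const n"
    unfolding eq by (simp only: right_diff_distrib mult_1_right)
qed

lemma gamma_const_pos: "0 < n \<Longrightarrow> 0 < gamma_const n"
  using one_minus_gamma_const_bounds(4)[of n] by linarith

text \<open>From 1/(1 - a) = 1 + a + a^2/(1 - a): one 1/n pays for replacing a by 1/sqrt(2 pi n),
  the other for the quadratic remainder, where 1 - a >= 1/2.\<close>

lemma inverse_gamma_const_expansion_bound:
  assumes "0 < n"
  shows "\<bar>inverse (gamma_const n) - (1 + 1 / sqrt (2 * pi * real n))\<bar> \<le> 2 / real n"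
proof -
  define a s where "a = 1 - gamma_const n" and "s = 1 / sqrt (2 * pi * real n)"
  have b: "s - 1 / real n \<le> a" "a \<le> s" "0 \<le> a" "a \<le> 1 / 2"
    using one_minus_gamma_const_bounds[OF assms] by (auto simp: a_def s_def)
  have "inverse (gamma_const n) - (1 + a) = a\<^sup>2 / (1 - a)"
    using b by (simp add: a_def field_simps power2_eq_square)
  moreover have "a\<^sup>2 / (1 - a) \<le> 1 / real n"
  proof -
    have "a\<^sup>2 \<le> s\<^sup>2" using b by (intro power_mono) auto
    also have "s\<^sup>2 = 1 / (2 * pi * real n)"
      using assms by (simp add: s_def power_divide)
    also have "\<dots> \<le> 1 / (4 * real n)"
      using assms pi_ge_two by (intro divide_left_mono) auto
    finally have "a\<^sup>2 / (1 - a) \<le> 1 / (4 * real n) / (1 / 2)"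
      using b by (intro frac_le) auto
    also have "\<dots> \<le> 1 / real n" using assms by (simp add: field_simps)
    finally show ?thesis .
  qed
  moreover have "0 \<le> a\<^sup>2 / (1 - a)" using b by simp
  moreover have "1 / real n + 1 / real n = 2 / real n" by simp
  ultimately have "\<bar>inverse (gamma_const n) - (1 + s)\<bar> \<le> 2 / real n"
    using b by linarith
  then show ?thesis unfolding s_def .
qed

lemma inverse_gamma_const_asymp:
  "(\<lambda>n. inverse (gamma_const n) - (1 + 1 / sqrt (2 * pi * real n))) \<in> O(\<lambda>n. 1 / real n)"
  by (rule bigoI[where c = 2], use eventually_gt_at_top[of 0] in eventually_elim)
    (use inverse_gamma_const_expansion_bound in simp)

lemma inverse_gamma_const_asymp_weak:
  "(\<lambda>n. inverse (gamma_const n) - 1) \<in> O(\<lambda>n. real n powr (- 1 / 2))"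
proof -
  have "(\<lambda>n. 1 / real n) \<in> O(\<lambda>n. real n powr (- 1 / 2))"
    by real_asymp
  with inverse_gamma_const_asymp
  have "(\<lambda>n. inverse (gamma_const n) - (1 + 1 / sqrt (2 * pi * real n))) \<in> O(\<lambda>n. real n powr (- 1 / 2))"
    by (rule landau_o.big_trans)
  moreover have "(\<lambda>n. 1 / sqrt (2 * pi * real n)) \<in> O(\<lambda>n. real n powr (- 1 / 2))"
    by real_asymp
  ultimately have "(\<lambda>n. (inverse (gamma_const n) - (1 + 1 / sqrt (2 * pi * real n)))
      + 1 / sqrt (2 * pi * real n)) \<in> O(\<lambda>n. real n powr (- 1 / 2))"
    by (rule sum_in_bigo)
  then show ?thesis by (simp add: algebra_simps)
qed

section \<open>Spectral theory of symmetric matrices\<close>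

lemma symmetric_inner_matrix:
  fixes A :: "real^'p^'p"
  assumes "transpose A = A"
  shows "x \<bullet> (A *v y) = (A *v x) \<bullet> y"
  by (metis assms dot_lmul_matrix vector_transpose_matrix)

text \<open>A maximizer \<open>u\<close> of the Rayleigh quotient on the orthogonal complement of the eigenvectors
  found so far is a further eigenvector: otherwise moving from \<open>u\<close> in the direction of
  the residual \<open>A u - \<lambda> u\<close> would increase the quotient.\<close>

lemma symmetric_matrix_extend_eigenvectors:
  fixes A :: "real^'p^'p"
  assumes sym: "transpose A = A"
    and eig: "\<And>b. b \<in> B \<Longrightarrow> \<exists>l. A *v b = l *\<^sub>R b"
    and "finite B" "card B < CARD('p)"
  shows "\<exists>u l. norm u = 1 \<and> (\<forall>b\<in>B. orthogonal b u) \<and> A *v u = l *\<^sub>R u"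
proof -
  define S where "S = {x. \<forall>b\<in>B. b \<bullet> x = 0}"
  have sub: "subspace S" by (auto simp: S_def subspace_def inner_right_distrib)
  have "dim (span B) < DIM(real^'p)"
    using assms(3,4) dim_le_card'[of B] by simp
  then obtain x0 where "x0 \<noteq> 0" "\<And>y. y \<in> span (span B) \<Longrightarrow> orthogonal x0 y"
    using orthogonal_to_subspace_exists[of "span B"] by blast
  then have "x0 \<in> S" by (auto simp: S_def orthogonal_def span_base inner_commute)
  let ?K = "sphere 0 1 \<inter> S"
  have "closed S" using sub by (rule closed_subspace)
  then have "compact ?K" by (intro compact_Int_closed) auto
  moreover have "(1 / norm x0) *\<^sub>R x0 \<in> ?K"
    using \<open>x0 \<noteq> 0\<close> \<open>x0 \<in> S\<close> sub by (simp add: subspace_scale)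
  moreover have "continuous_on ?K (\<lambda>x. x \<bullet> (A *v x))"
    by (intro continuous_intros)
  ultimately obtain u where u: "u \<in> ?K" "\<And>x. x \<in> ?K \<Longrightarrow> x \<bullet> (A *v x) \<le> u \<bullet> (A *v u)"
    using continuous_attains_sup[of ?K "\<lambda>x. x \<bullet> (A *v x)"] by blast
  define l where "l = u \<bullet> (A *v u)"
  have uS: "u \<in> S" and nu: "norm u = 1" "u \<bullet> u = 1" using u(1) by (auto simp: norm_eq_1)
  have le: "x \<bullet> (A *v x) \<le> l * (x \<bullet> x)" if "x \<in> S" for x
  proof (cases "x = 0")
    case False
    have "(1 / norm x) *\<^sub>R x \<in> ?K" using False that sub by (simp add: subspace_scale)
    from u(2)[OF this] have "(x \<bullet> (A *v x)) / (norm x)\<^sup>2 \<le> l"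
      by (simp add: l_def matrix_vector_mult_scaleR power2_eq_square)
    then show ?thesis using False by (simp add: field_simps dot_square_norm)
  qed simp
  define w where "w = A *v u - l *\<^sub>R u"
  \<comment> \<open>By symmetry the orthogonal complement of eigenvectors is invariant, so the
    residual \<open>w\<close> stays in the subspace where \<open>le\<close> applies.\<close>
  have AS: "A *v x \<in> S" if "x \<in> S" for x
    unfolding S_def
  proof safe
    fix b assume "b \<in> B"
    with eig obtain k where "A *v b = k *\<^sub>R b" by blast
    then have "b \<bullet> (A *v x) = k * (b \<bullet> x)" by (simp add: symmetric_inner_matrix[OF sym])
    then show "b \<bullet> (A *v x) = 0" using that \<open>b \<in> B\<close> by (simp add: S_def)
  qed
  have wS: "w \<in> S" unfolding w_def using AS uS sub by (simp add: subspace_diff subspace_scale)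
  have "u \<bullet> w = 0" using nu by (simp add: w_def inner_diff_right l_def)
  then have wu: "w \<bullet> u = 0" by (simp add: inner_commute)
  have wAu: "w \<bullet> (A *v u) = w \<bullet> w"
    using wu by (simp add: w_def inner_diff_left inner_diff_right inner_commute)
  define C where "C = l * (w \<bullet> w) - w \<bullet> (A *v w)"
  \<comment> \<open>Maximality, tested at \<open>u + t *\<^sub>R w\<close>, bounds the first-order
    gain 2 t |w|^2 by the second-order term t^2 C. Dividing by t and letting t tend to 0 forces
    \<open>w = 0\<close>.\<close>
  have "2 * (w \<bullet> w) \<le> t * C" if "t > 0" for t
  proof -
    have "u + t *\<^sub>R w \<in> S" using uS wS sub by (simp add: subspace_add subspace_scale)
    from le[OF this] have "l + 2 * t * (w \<bullet> w) + t\<^sup>2 * (w \<bullet> (A *v w)) \<le> l * (1 + t\<^sup>2 * (w \<bullet> w))"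
      using wu wAu nu symmetric_inner_matrix[OF sym, of u w]
      by (simp add: matrix_vector_right_distrib matrix_vector_mult_scaleR inner_add_left
          inner_add_right l_def[symmetric] inner_commute power2_eq_square algebra_simps)
    then have "t * (2 * (w \<bullet> w)) \<le> t * (t * C)"
      by (simp add: C_def algebra_simps power2_eq_square)
    then show ?thesis using that by simp
  qed
  then have *: "2 * (w \<bullet> w) \<le> inverse (real (Suc n)) * C" for n by simp
  have "(\<lambda>n. inverse (real (Suc n)) * C) \<longlonglongrightarrow> 0 * C"
    by (intro tendsto_mult LIMSEQ_inverse_real_of_nat) simp
  then have "2 * (w \<bullet> w) \<le> 0 * C"
    by (rule LIMSEQ_le_const) (use * in blast)
  then have "w = 0" using inner_gt_zero_iff[of w] by linarith
  then have "A *v u = l *\<^sub>R u" by (simp add: w_def)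
  moreover have "\<forall>b\<in>B. orthogonal b u" using uS by (simp add: S_def orthogonal_def)
  ultimately show ?thesis using nu by blast
qed

theorem symmetric_matrix_orthonormal_eigenbasis:
  fixes A :: "real^'p^'p"
  assumes sym: "transpose A = A"
  obtains V l where "orthogonal_matrix V" "\<And>i. A *v column i V = l i *\<^sub>R column i V"
proof -
  have "\<exists>B. finite B \<and> card B = n \<and> (\<forall>b\<in>B. norm b = 1 \<and> (\<exists>l. A *v b = l *\<^sub>R b)) \<and>
      (\<forall>b\<in>B. \<forall>c\<in>B. b \<noteq> c \<longrightarrow> orthogonal b c)" if "n \<le> CARD('p)" for n
    using that
  proof (induction n)
    case 0
    show ?case by (intro exI[of _ "{}"]) simp
  next
    case (Suc n)
    then obtain B where B: "finite B" "card B = n" "\<And>b. b \<in> B \<Longrightarrow> norm b = 1 \<and> (\<exists>l. A *v b = l *\<^sub>R b)"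
      "\<And>b c. b \<in> B \<Longrightarrow> c \<in> B \<Longrightarrow> b \<noteq> c \<Longrightarrow> orthogonal b c" by auto
    obtain u l where u: "norm u = 1" "\<forall>b\<in>B. orthogonal b u" "A *v u = l *\<^sub>R u"
      using symmetric_matrix_extend_eigenvectors[OF sym, of B] B Suc.prems by auto
    have "u \<notin> B" using u(1,2) by (auto simp: orthogonal_def)
    then show ?case
      using B u by (intro exI[of _ "insert u B"]) (auto simp: orthogonal_commute)
  qed
  from this[of "CARD('p)"] obtain B where B: "finite B" "card B = CARD('p)"
    "\<And>b. b \<in> B \<Longrightarrow> norm b = 1" "\<And>b. b \<in> B \<Longrightarrow> \<exists>l. A *v b = l *\<^sub>R b"
    "\<And>b c. b \<in> B \<Longrightarrow> c \<in> B \<Longrightarrow> b \<noteq> c \<Longrightarrow> orthogonal b c" by auto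
  obtain f where f: "bij_betw f (UNIV :: 'p set) B"
    using B(1,2) finite_same_card_bij[of "UNIV :: 'p set" B] by auto
  have fB: "f i \<in> B" for i using f by (auto simp: bij_betw_def)
  define V :: "real^'p^'p" where "V = (\<chi> i j. f j $ i)"
  have col: "column i V = f i" for i by (simp add: column_def V_def vec_eq_iff)
  have "orthogonal_matrix V"
    unfolding orthogonal_matrix_orthonormal_columns col
    using B(3,5) fB bij_betw_imp_inj_on[OF f] by (metis injD)
  moreover have "\<forall>i. \<exists>l. A *v column i V = l *\<^sub>R column i V"
    using B(4) fB unfolding col by blast
  ultimately show ?thesis using that by metis
qed

section \<open>Orthonormal columns and diagonalization\<close>

lemma orthonormal_columns_inner:
  fixes V :: "real^'p^'p"
  assumes "orthogonal_matrix V"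
  shows "column i V \<bullet> column j V = (if i = j then 1 else 0)"
  using assms unfolding orthogonal_matrix_orthonormal_columns
  by (auto simp: orthogonal_def norm_eq_1)

lemma orthonormal_columns_expand:
  fixes V :: "real^'p^'p"
  assumes "orthogonal_matrix V"
  shows "x = (\<Sum>i\<in>UNIV. (column i V \<bullet> x) *\<^sub>R column i V)"
proof -
  have "x = V *v (transpose V *v x)"
    using assms unfolding orthogonal_matrix_def
    by (metis matrix_vector_mul_assoc matrix_vector_mul_lid)
  also have "\<dots> = (\<Sum>i\<in>UNIV. (transpose V *v x) $ i *s column i V)"
    by (rule matrix_mult_sum)
  also have "\<dots> = (\<Sum>i\<in>UNIV. (column i V \<bullet> x) *\<^sub>R column i V)"
    by (simp add: scalar_mult_eq_scaleR matrix_vector_mul_component row_transpose[symmetric]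
        row_def transpose_def column_def inner_vec_def matrix_vector_mult_def)
  finally show ?thesis .
qed

lemma orthonormal_columns_parseval:
  fixes V :: "real^'p^'p"
  assumes "orthogonal_matrix V"
  shows "x \<bullet> x = (\<Sum>i\<in>UNIV. (column i V \<bullet> x)\<^sup>2)"
proof -
  have "x \<bullet> x = x \<bullet> (\<Sum>i\<in>UNIV. (column i V \<bullet> x) *\<^sub>R column i V)"
    using orthonormal_columns_expand[OF assms, of x] by simp
  then show ?thesis by (simp add: inner_sum_right inner_commute power2_eq_square)
qed

lemma trace_orthonormal_columns:
  fixes A V :: "real^'p^'p"
  assumes "orthogonal_matrix V"
  shows "trace A = (\<Sum>i\<in>UNIV. column i V \<bullet> (A *v column i V))"
proof -
  have "trace A = trace ((A ** V) ** transpose V)"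
    using assms by (simp add: matrix_mul_assoc[symmetric] orthogonal_matrix_def)
  also have "\<dots> = trace (transpose V ** (A ** V))" by (rule trace_mul_sym)
  also have "\<dots> = (\<Sum>i\<in>UNIV. column i V \<bullet> (A *v column i V))"
    by (simp add: trace_def matrix_matrix_mult_def transpose_def column_def inner_vec_def
        matrix_vector_mult_def)
  finally show ?thesis .
qed

context
  fixes A V :: "real^'p^'p" and l :: "'p \<Rightarrow> real"
  assumes V: "orthogonal_matrix V" and eig: "\<And>i. A *v column i V = l i *\<^sub>R column i V"
begin

lemma quadratic_form_eigenbasis: "x \<bullet> (A *v x) = (\<Sum>i\<in>UNIV. l i * (column i V \<bullet> x)\<^sup>2)"
proof -
  have "A *v x = A *v (\<Sum>i\<in>UNIV. (column i V \<bullet> x) *\<^sub>R column i V)"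
    using orthonormal_columns_expand[OF V, of x] by simp
  also have "\<dots> = (\<Sum>i\<in>UNIV. (column i V \<bullet> x) *\<^sub>R (l i *\<^sub>R column i V))"
    by (simp add: linear_sum[OF matrix_vector_mul_linear] matrix_vector_mult_scaleR eig)
  finally show ?thesis
    by (simp add: inner_sum_right power2_eq_square inner_commute mult_ac)
qed

text \<open>Eigenvectors with nonzero eigenvalue span the range of \<open>A\<close>, each being the
  image of a multiple of itself. This lets the rank count the nondegenerate coordinates.\<close>

lemma rank_eigenbasis: "rank A = card {i. l i \<noteq> 0}"
proof -
  let ?B = "(\<lambda>i. column i V) ` {i. l i \<noteq> 0}"
  have unit: "column i V \<bullet> column j V = (if i = j then 1 else 0)" for i j
    by (rule orthonormal_columns_inner[OF V])
  have inj: "inj_on (\<lambda>i. column i V) UNIV"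
    by (rule inj_onI) (metis unit zero_neq_one)
  have "span (range ((*v) A)) = span ?B"
  unfolding span_eq
  proof
    show "range ((*v) A) \<subseteq> span ?B"
    proof safe
      fix x
      have "A *v x = A *v (\<Sum>i\<in>UNIV. (column i V \<bullet> x) *\<^sub>R column i V)"
        using orthonormal_columns_expand[OF V, of x] by simp
      also have "\<dots> = (\<Sum>i\<in>UNIV. ((column i V \<bullet> x) * l i) *\<^sub>R column i V)"
        by (simp add: linear_sum[OF matrix_vector_mul_linear] matrix_vector_mult_scaleR eig)
      also have "\<dots> \<in> span ?B"
      proof (rule span_sum)
        fix i show "((column i V \<bullet> x) * l i) *\<^sub>R column i V \<in> span ?B"
          by (cases "l i = 0") (auto intro: span_scale span_base span_zero)
      qed
      finally show "A *v x \<in> span ?B" .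
    qed
    show "?B \<subseteq> span (range ((*v) A))"
    proof safe
      fix i assume "l i \<noteq> 0"
      then have "column i V = A *v ((1 / l i) *\<^sub>R column i V)"
        by (simp add: matrix_vector_mult_scaleR eig)
      then show "column i V \<in> span (range ((*v) A))" by (metis rangeI span_base)
    qed
  qed
  then have "rank A = dim ?B"
    unfolding rank_dim_range by (metis dim_span)
  also have "\<dots> = card ?B"
  proof (rule dim_eq_card_independent[OF pairwise_orthogonal_independent])
    show "pairwise orthogonal ?B" by (auto simp: pairwise_def orthogonal_def unit)
    show "0 \<notin> ?B" using unit by (metis (no_types, lifting) imageE inner_zero_left zero_neq_one)
  qed
  also have "\<dots> = card {i. l i \<noteq> 0}"
    using inj by (intro card_image) (auto simp: inj_on_def)
  finally show ?thesis .
qed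

text \<open>Diagonalization takes place over the polynomial ring, as (X - A) V = V D with the linear
  factors in D. After taking determinants, det V cancels in the integral domain of polynomials; it
  is nonzero because V times its transpose is the identity.\<close>

lemma charpoly_eigenbasis: "charpoly A = (\<Prod>i\<in>UNIV. [:- l i, 1:])"
proof -
  let ?C = "map_matrix (\<lambda>a::real. [:a:])"
  let ?X = "mat (monom 1 1) :: real poly^'p^'p"
  define D :: "real poly^'p^'p" where "D = (\<chi> i j. if i = j then [:- l i, 1:] else 0)"
  have csum: "(\<Sum>k\<in>S. [:g k:]) = [:\<Sum>k\<in>S. g k:]" for g :: "'p \<Rightarrow> real" and S
    by (induction S rule: infinite_finite_induct) auto
  have mul: "?C P ** ?C Q = ?C (P ** Q)" for P Q :: "real^'p^'p"
    by (simp add: vec_eq_iff matrix_matrix_mult_def csum) (simp add: mult.commute)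
  have AV: "(A ** V) $ i $ j = l j * V $ i $ j" for i j
    using eig[of j] by (simp add: vec_eq_iff column_def matrix_matrix_mult_def matrix_vector_mult_def)
  have XP: "(?X ** P) $ i $ j = monom 1 1 * P $ i $ j" for P i j
    by (simp add: matrix_matrix_mult_def mat_def if_distrib[of "\<lambda>x. x * _"] cong: if_cong)
  have PD: "(P ** D) $ i $ j = P $ i $ j * [:- l j, 1:]" for P i j
    by (simp add: matrix_matrix_mult_def D_def if_distrib[of "\<lambda>x. _ * x"] cong: if_cong)
  have "(?X - ?C A) ** ?C V = ?X ** ?C V - ?C (A ** V)"
    unfolding mul[symmetric]
    by (simp add: vec_eq_iff matrix_matrix_mult_def left_diff_distrib sum_subtractf smult_diff_right)
  also have "\<dots> = ?C V ** D"
    unfolding vec_eq_iff vector_minus_component XP PD nth_map_matrix AV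
    by (simp add: monom_altdef)
  finally have "det (?X - ?C A) * det (?C V) = det (?C V) * det D"
    by (metis det_mul)
  moreover have "det (?C V) * det (?C (transpose V)) = 1"
  proof -
    have "?C V ** ?C (transpose V) = mat 1"
      using V unfolding mul by (simp add: orthogonal_matrix_def vec_eq_iff mat_def)
    then show ?thesis by (metis det_mul det_I)
  qed
  then have "det (?C V) \<noteq> 0" by auto
  ultimately have "charpoly A = det D" by (simp add: charpoly_def)
  also have "\<dots> = (\<Prod>i\<in>UNIV. [:- l i, 1:])"
    by (subst det_diagonal) (auto simp: D_def)
  finally show ?thesis .
qed

lemma eigvals_eigenbasis: "eigvals A = decr_rearrangement UNIV l"
proof -
  have "proots (\<Prod>i\<in>UNIV. [:- l i, 1:]) = (\<Sum>i\<in>UNIV. {#l i#})"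
    by (subst proots_prod) auto
  also have "\<dots> = image_mset l (mset_set UNIV)"
    by (simp add: sum_unfold_sum_mset)
  finally show ?thesis
    by (simp add: eigvals_def decr_rearrangement_def charpoly_eigenbasis)
qed

end

section \<open>Sums of the largest coordinates\<close>

text \<open>The rearrangement is a bare list of values. Sorting the indices by value recovers an
  index for every position, ties included, so that sums over positions can be reindexed.\<close>

lemma decr_rearrangement_enum:
  assumes "finite I"
  obtains \<pi> where "bij_betw \<pi> {..<card I} I"
    and "\<And>j. j < card I \<Longrightarrow> decr_rearrangement I a ! j = a (\<pi> j)"
    and "\<And>i j. i \<le> j \<Longrightarrow> j < card I \<Longrightarrow> a (\<pi> j) \<le> a (\<pi> i)"
proof -
  obtain xs where xs: "set xs = I" "distinct xs"
    using finite_distinct_list[OF assms] by blast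
  define ys where "ys = rev (sort_key a xs)"
  have ys: "set ys = I" "distinct ys" "length ys = card I"
    using xs by (auto simp: ys_def distinct_card)
  have sorted: "sorted (map a (rev ys))"
    by (simp add: ys_def)
  have "mset (map a (rev ys)) = image_mset a (mset_set I)"
    using ys(1,2) by (metis mset_map mset_rev mset_set_set)
  then have "sorted_list_of_multiset (image_mset a (mset_set I)) = map a (rev ys)"
    using sorted by (metis sorted_list_of_multiset_mset sorted_sort_id)
  then have decr: "decr_rearrangement I a = map a ys"
    by (simp add: decr_rearrangement_def rev_map)
  have "bij_betw ((!) ys) {..<card I} I"
    using bij_betw_nth[OF ys(2)] ys by simp
  moreover have "decr_rearrangement I a ! j = a (ys ! j)" if "j < card I" for j
    using that ys by (simp add: decr)
  moreover have "a (ys ! j) \<le> a (ys ! i)" if "i \<le> j" "j < card I" for i j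
  proof -
    have "sorted (rev (map a ys))" using sorted by (simp add: rev_map)
    then show ?thesis
      using that ys sorted_rev_nth_mono[of "map a ys" i j] by simp
  qed
  ultimately show ?thesis by (rule that)
qed

lemma Top_reindex:
  assumes "bij_betw h I J"
  shows "Top d I (\<lambda>i. a (h i)) = Top d J a"
proof -
  have "image_mset (\<lambda>i. a (h i)) (mset_set I) = image_mset a (image_mset h (mset_set I))"
    by (simp add: multiset.map_comp comp_def)
  also have "image_mset h (mset_set I) = mset_set J"
    using assms by (metis bij_betw_def image_mset_mset_set)
  finally show ?thesis by (simp add: Top_def decr_rearrangement_def)
qed

lemma downward_closed_eq_lessThan_card:
  fixes S :: "nat set"
  assumes "finite S" "\<And>i j. i \<le> j \<Longrightarrow> j \<in> S \<Longrightarrow> i \<in> S"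
  shows "S = {..<card S}"
proof (intro set_eqI iffI)
  fix j assume "j \<in> S"
  then have "{..j} \<subseteq> S" using assms(2) by auto
  from card_mono[OF assms(1) this] show "j \<in> {..<card S}" by simp
next
  fix j assume j: "j \<in> {..<card S}"
  show "j \<in> S"
  proof (rule ccontr)
    assume "j \<notin> S"
    then have "S \<subseteq> {..<j}" using assms(2)[of j] by (auto simp: not_less[symmetric])
    from card_mono[OF _ this] show False using j by simp
  qed
qed

text \<open>A sum of indicators rather than a cardinality, which makes joint measurability in values
  and level immediate.\<close>

definition exceedances :: "'i set \<Rightarrow> ('i \<Rightarrow> real) \<Rightarrow> real \<Rightarrow> real" where
  "exceedances I a s = (\<Sum>i\<in>I. if s < a i then 1 else 0)"

lemma exceedances_mono:
  assumes "finite I" "J \<subseteq> I"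
  shows "exceedances J a s \<le> exceedances I a s"
  unfolding exceedances_def using assms by (intro sum_mono2) auto

text \<open>The \<open>d\<close> largest coordinates contain exactly \<open>min(d, N)\<close>
  of the \<open>N\<close> coordinates exceeding a given level.\<close>

lemma Top_layer_cake:
  assumes "finite I" "d \<le> card I" "\<And>i. i \<in> I \<Longrightarrow> 0 \<le> a i"
  shows "ennreal (Top d I a) =
    (\<integral>\<^sup>+s. ennreal (min (real d) (exceedances I a s)) * indicator {0..} s \<partial>lborel)"
proof -
  obtain \<pi> where \<pi>: "bij_betw \<pi> {..<card I} I"
    "\<And>j. j < card I \<Longrightarrow> decr_rearrangement I a ! j = a (\<pi> j)"
    "\<And>i j. i \<le> j \<Longrightarrow> j < card I \<Longrightarrow> a (\<pi> j) \<le> a (\<pi> i)"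
    using decr_rearrangement_enum[OF assms(1), of a] by blast
  have nn: "0 \<le> a (\<pi> j)" if "j < card I" for j
    using that assms(3) bij_betwE[OF \<pi>(1)] by auto
  have count: "(\<Sum>j<d. if s < a (\<pi> j) then 1 else 0) = min (real d) (exceedances I a s)" for s
  proof -
    define S where "S = {j\<in>{..<card I}. s < a (\<pi> j)}"
    \<comment> \<open>Values decrease along positions, so the positions exceeding \<open>s\<close>
      form an initial segment; it meets the first d positions in a shorter initial segment.\<close>
    have S: "S = {..<card S}"
    proof (rule downward_closed_eq_lessThan_card)
      fix i j assume "i \<le> j" "j \<in> S"
      then show "i \<in> S" using \<pi>(3)[of i j] by (auto simp: S_def)
    qed (simp add: S_def)
    have "exceedances I a s = (\<Sum>j<card I. if s < a (\<pi> j) then 1 else 0)"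
      unfolding exceedances_def using \<pi>(1) by (rule sum.reindex_bij_betw[symmetric])
    also have "\<dots> = real (card S)"
      by (simp add: S_def sum.If_cases Int_def)
    finally have ex: "exceedances I a s = real (card S)" .
    have "(\<Sum>j<d. if s < a (\<pi> j) then 1 else 0) = real (card ({..<d} \<inter> {j. s < a (\<pi> j)}))"
      by (simp add: sum.If_cases)
    also have "{..<d} \<inter> {j. s < a (\<pi> j)} = {..<d} \<inter> S"
      using assms(2) by (auto simp: S_def)
    also have "\<dots> = {..<min d (card S)}" by (subst S) auto
    finally show ?thesis by (simp add: ex)
  qed
  have "Top d I a = (\<Sum>j<d. a (\<pi> j))"
    unfolding Top_def using assms(2) \<pi>(2) by (intro sum.cong) auto
  then have "ennreal (Top d I a) = (\<Sum>j<d. ennreal (a (\<pi> j)))"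
    using assms(2) nn by (simp only:) (intro sum_ennreal[symmetric], auto)
  also have "\<dots> = (\<Sum>j<d. \<integral>\<^sup>+s. indicator {0..<a (\<pi> j)} s \<partial>lborel)"
    using nn assms(2) by (intro sum.cong) auto
  also have "\<dots> = (\<integral>\<^sup>+s. (\<Sum>j<d. indicator {0..<a (\<pi> j)} s) \<partial>lborel)"
    by (rule nn_integral_sum[symmetric]) simp
  also have "\<dots> = (\<integral>\<^sup>+s. ennreal (min (real d) (exceedances I a s)) * indicator {0..} s \<partial>lborel)"
  proof (rule nn_integral_cong)
    fix s
    have "(\<Sum>j<d. indicator {0..<a (\<pi> j)} s) =
        (\<Sum>j<d. ennreal (if s < a (\<pi> j) then 1 else 0)) * indicator {0..} s"
      unfolding sum_distrib_right by (intro sum.cong) (auto simp: indicator_def)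
    also have "(\<Sum>j<d. ennreal (if s < a (\<pi> j) then 1 else 0)) =
        ennreal (\<Sum>j<d. if s < a (\<pi> j) then 1 else 0)"
      by (intro sum_ennreal) auto
    finally show "(\<Sum>j<d. indicator {0..<a (\<pi> j)} s) =
        ennreal (min (real d) (exceedances I a s)) * indicator {0..} s"
      by (simp only: count)
  qed
  finally show ?thesis .
qed

text \<open>Each of the d chosen entries is at most t plus its excess over t, and extending the sum
  of excesses to all indices adds nonnegative terms. The bound no longer refers to the ordering, so
  its expectation involves one coordinate at a time.\<close>

lemma Top_le_threshold:
  assumes "finite I" "d \<le> card I"
  shows "Top d I a \<le> real d * t + (\<Sum>i\<in>I. max 0 (a i - t))"
proof -
  obtain \<pi> where \<pi>: "bij_betw \<pi> {..<card I} I"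
    "\<And>j. j < card I \<Longrightarrow> decr_rearrangement I a ! j = a (\<pi> j)"
    "\<And>i j. i \<le> j \<Longrightarrow> j < card I \<Longrightarrow> a (\<pi> j) \<le> a (\<pi> i)"
    using decr_rearrangement_enum[OF assms(1), of a] by blast
  have "Top d I a = (\<Sum>j<d. a (\<pi> j))"
    unfolding Top_def using assms(2) \<pi>(2) by (intro sum.cong) auto
  also have "\<dots> \<le> (\<Sum>j<d. t + max 0 (a (\<pi> j) - t))"
    by (intro sum_mono) auto
  also have "\<dots> = real d * t + (\<Sum>j<d. max 0 (a (\<pi> j) - t))"
    by (simp add: sum.distrib)
  also have "(\<Sum>j<d. max 0 (a (\<pi> j) - t)) \<le> (\<Sum>j<card I. max 0 (a (\<pi> j) - t))"
    using assms(2) by (intro sum_mono2) auto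
  also have "\<dots> = (\<Sum>i\<in>I. max 0 (a i - t))"
    using \<pi>(1) by (rule sum.reindex_bij_betw)
  finally show ?thesis by simp
qed

lemma Top_nonneg:
  assumes "finite I" "d \<le> card I" "\<And>i. i \<in> I \<Longrightarrow> 0 \<le> a i"
  shows "0 \<le> Top d I a"
proof -
  obtain \<pi> where \<pi>: "bij_betw \<pi> {..<card I} I"
    "\<And>j. j < card I \<Longrightarrow> decr_rearrangement I a ! j = a (\<pi> j)"
    "\<And>i j. i \<le> j \<Longrightarrow> j < card I \<Longrightarrow> a (\<pi> j) \<le> a (\<pi> i)"
    using decr_rearrangement_enum[OF assms(1), of a] by blast
  show ?thesis
    unfolding Top_def using assms(2,3) \<pi>(2) bij_betwE[OF \<pi>(1)] by (intro sum_nonneg) auto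
qed

lemma Top_le_sum:
  assumes "finite I" "d \<le> card I" "\<And>i. i \<in> I \<Longrightarrow> 0 \<le> a i"
  shows "Top d I a \<le> (\<Sum>i\<in>I. a i)"
proof -
  have "(\<Sum>i\<in>I. max 0 (a i - 0)) = (\<Sum>i\<in>I. a i)"
    using assms(3) by (intro sum.cong) auto
  then show ?thesis using Top_le_threshold[OF assms(1,2), of a 0] by simp
qed

text \<open>A nonzero entry at position j >= d would be preceded by positive entries only, giving j
  + 1 > d of them because positions count from 0. So all positions from d on carry 0.\<close>

lemma Top_eq_sum:
  assumes "finite I" "d \<le> card I" "\<And>i. i \<in> I \<Longrightarrow> 0 \<le> a i" "card {i\<in>I. a i \<noteq> 0} \<le> d"
  shows "Top d I a = (\<Sum>i\<in>I. a i)"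
proof -
  obtain \<pi> where \<pi>: "bij_betw \<pi> {..<card I} I"
    "\<And>j. j < card I \<Longrightarrow> decr_rearrangement I a ! j = a (\<pi> j)"
    "\<And>i j. i \<le> j \<Longrightarrow> j < card I \<Longrightarrow> a (\<pi> j) \<le> a (\<pi> i)"
    using decr_rearrangement_enum[OF assms(1), of a] by blast
  have inj: "inj_on \<pi> {..<card I}" using \<pi>(1) by (rule bij_betw_imp_inj_on)
  have zero: "a (\<pi> j) = 0" if "d \<le> j" "j < card I" for j
  proof (rule ccontr)
    assume "a (\<pi> j) \<noteq> 0"
    then have "0 < a (\<pi> j)" using assms(3)[of "\<pi> j"] bij_betwE[OF \<pi>(1)] that by fastforce
    have "\<pi> ` {..j} \<subseteq> {i\<in>I. a i \<noteq> 0}"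
    proof safe
      fix i assume "i \<le> j"
      then have "0 < a (\<pi> i)" using \<pi>(3)[of i j] \<open>0 < a (\<pi> j)\<close> that by linarith
      then show "a (\<pi> i) = 0 \<Longrightarrow> False" by simp
      show "\<pi> i \<in> I" using bij_betwE[OF \<pi>(1)] \<open>i \<le> j\<close> that by simp
    qed
    from card_mono[OF _ this] have "card (\<pi> ` {..j}) \<le> d"
      using assms(1,4) by simp
    moreover have "card (\<pi> ` {..j}) = Suc j"
      using inj_on_subset[OF inj, of "{..j}"] that by (simp add: card_image subset_iff)
    ultimately show False using that by simp
  qed
  have "Top d I a = (\<Sum>j<d. a (\<pi> j))"
    unfolding Top_def using assms(2) \<pi>(2) by (intro sum.cong) auto
  also have "\<dots> = (\<Sum>j<card I. a (\<pi> j))"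
    using assms(2) zero by (intro sum.mono_neutral_left) auto
  also have "\<dots> = (\<Sum>i\<in>I. a i)"
    using \<pi>(1) by (rule sum.reindex_bij_betw)
  finally show ?thesis .
qed

lemma borel_measurable_exceedances [measurable]:
  assumes [measurable]: "\<And>i. i \<in> I \<Longrightarrow> a i \<in> borel_measurable M" "s \<in> borel_measurable M"
  shows "(\<lambda>\<omega>. exceedances I (\<lambda>i. a i \<omega>) (s \<omega>)) \<in> borel_measurable M"
  unfolding exceedances_def by measurable

text \<open>Read off from the layer-cake formula, an integral over the level of a jointly measurable
  integrand; the sorting itself never has to be analysed.\<close>

lemma borel_measurable_Top:
  assumes "finite I" "d \<le> card I" "\<And>i \<omega>. i \<in> I \<Longrightarrow> 0 \<le> a i \<omega>"
    and [measurable]: "\<And>i. i \<in> I \<Longrightarrow> a i \<in> borel_measurable M"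
  shows "(\<lambda>\<omega>. Top d I (\<lambda>i. a i \<omega>)) \<in> borel_measurable M"
proof -
  have "(\<lambda>\<omega>. enn2real (\<integral>\<^sup>+s. ennreal (min (real d) (exceedances I (\<lambda>i. a i \<omega>) s))
      * indicator {0..} s \<partial>lborel)) \<in> borel_measurable M"
    by measurable
  also have "(\<lambda>\<omega>. enn2real (\<integral>\<^sup>+s. ennreal (min (real d) (exceedances I (\<lambda>i. a i \<omega>) s))
      * indicator {0..} s \<partial>lborel)) = (\<lambda>\<omega>. Top d I (\<lambda>i. a i \<omega>))"
    using assms(1-3) by (simp add: Top_layer_cake[symmetric] Top_nonneg)
  finally show ?thesis .
qed

section \<open>Independence and the correlation gap\<close>

text \<open>Levy uniqueness passes from exponentials to indicators, but it speaks of probability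
  measures while \<open>U\<close> is signed. Hence \<open>U\<close> is first shifted and normalized
  to a density.\<close>

lemma (in prob_space) real_weight_factor_char:
  fixes U X :: "'a \<Rightarrow> real"
  assumes [measurable]: "U \<in> borel_measurable M" "X \<in> borel_measurable M"
    and U: "\<And>\<omega>. \<bar>U \<omega>\<bar> \<le> 1"
    and fac: "\<And>t. (\<integral>\<omega>. of_real (U \<omega>) * iexp (t * X \<omega>) \<partial>M) = of_real u * (\<integral>\<omega>. iexp (t * X \<omega>) \<partial>M)"
    and [measurable]: "B \<in> sets borel"
  shows "(\<integral>\<omega>. U \<omega> * indicator B (X \<omega>) \<partial>M) = u * (\<integral>\<omega>. indicator B (X \<omega>) \<partial>M)"
proof -
  have intU: "integrable M U"
    using U by (intro integrable_const_bound[where B = 1]) auto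
  have EU: "(\<integral>\<omega>. U \<omega> \<partial>M) = u"
    using fac[of 0] by (simp add: prob_space)
  have "\<bar>u\<bar> \<le> 1"
  proof -
    have "norm (\<integral>\<omega>. U \<omega> \<partial>M) \<le> (\<integral>\<omega>. norm (U \<omega>) \<partial>M)" by (rule integral_norm_bound)
    also have "\<dots> \<le> (\<integral>\<omega>. 1 \<partial>M)" using U intU by (intro integral_mono) auto
    finally show ?thesis by (simp add: EU prob_space)
  qed
  \<comment> \<open>Both \<open>U\<close> and its mean u (frequency 0 in \<open>fac\<close>) lie in
    [-1, 1], so the shift by 2 makes numerator and denominator at least 1.\<close>
  define w where "w \<omega> = (2 + U \<omega>) / (2 + u)" for \<omega>
  have [measurable]: "w \<in> borel_measurable M" by (simp add: w_def[abs_def])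
  have w0: "0 \<le> w \<omega>" for \<omega>
    using U[of \<omega>] \<open>\<bar>u\<bar> \<le> 1\<close> by (simp add: w_def)
  have Ew: "(\<integral>\<omega>. w \<omega> \<partial>M) = 1"
    using intU EU \<open>\<bar>u\<bar> \<le> 1\<close> by (simp add: w_def prob_space)
  have intw: "integrable M w"
    using intU by (simp add: w_def[abs_def])
  let ?N = "density M w"
  have "prob_space ?N"
  proof
    have "emeasure ?N (space ?N) = (\<integral>\<^sup>+\<omega>. ennreal (w \<omega>) \<partial>M)"
      by (simp add: emeasure_density cong: nn_integral_cong)
    also have "\<dots> = 1" using intw w0 Ew by (simp add: nn_integral_eq_integral)
    finally show "emeasure ?N (space ?N) = 1" .
  qed
  then interpret N: prob_space ?N .
  have intexp: "integrable M (\<lambda>\<omega>. iexp (t * X \<omega>))" for t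
    by (intro integrable_const_bound[where B = 1]) auto
  have intUexp: "integrable M (\<lambda>\<omega>. of_real (U \<omega>) * iexp (t * X \<omega>))" for t
    using U by (intro integrable_const_bound[where B = 1]) (auto simp: norm_mult)
  have "char (distr ?N borel X) = char (distr M borel X)"
  proof
    fix t
    have "char (distr ?N borel X) t = (\<integral>\<omega>. w \<omega> *\<^sub>R iexp (t * X \<omega>) \<partial>M)"
      unfolding char_def using w0 by (simp add: integral_distr integral_density)
    also have "\<dots> = (\<integral>\<omega>. (2 * iexp (t * X \<omega>) + of_real (U \<omega>) * iexp (t * X \<omega>)) / of_real (2 + u) \<partial>M)"
      by (simp add: w_def scaleR_conv_of_real algebra_simps)
    also have "\<dots> = (2 * (\<integral>\<omega>. iexp (t * X \<omega>) \<partial>M) + of_real u * (\<integral>\<omega>. iexp (t * X \<omega>) \<partial>M)) / of_real (2 + u)"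
      unfolding integral_divide_zero
      by (subst Bochner_Integration.integral_add) (use intexp[of t] intUexp[of t] fac[of t] in auto)
    also have "\<dots> = (\<integral>\<omega>. iexp (t * X \<omega>) \<partial>M)"
    proof -
      have "complex_of_real (2 + u) \<noteq> 0" using \<open>\<bar>u\<bar> \<le> 1\<close> by (simp only: of_real_eq_0_iff)
      then show ?thesis by (simp add: distrib_right[symmetric])
    qed
    also have "\<dots> = char (distr M borel X) t"
      unfolding char_def by (simp add: integral_distr)
    finally show "char (distr ?N borel X) t = char (distr M borel X) t" .
  qed
  moreover have "real_distribution (distr ?N borel X)"
    by (rule N.real_distribution_distr) simp
  moreover have "real_distribution (distr M borel X)"
    by (rule real_distribution_distr) simp
  ultimately have "distr ?N borel X = distr M borel X"
    by (intro Levy_uniqueness)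
  moreover have "(\<integral>x. indicator B x \<partial>distr ?N borel X) = (\<integral>\<omega>. w \<omega> * indicator B (X \<omega>) \<partial>M)"
    using w0 by (subst integral_distr) (auto simp: integral_density)
  moreover have "(\<integral>x. indicator B x \<partial>distr M borel X) = (\<integral>\<omega>. (indicator B (X \<omega>) :: real) \<partial>M)"
    by (subst integral_distr) auto
  ultimately have "(\<integral>\<omega>. w \<omega> * indicator B (X \<omega>) \<partial>M) = (\<integral>\<omega>. indicator B (X \<omega>) \<partial>M)"
    by (simp only:)
  moreover have "(\<integral>\<omega>. w \<omega> * indicator B (X \<omega>) \<partial>M) =
      (\<integral>\<omega>. (2 * indicator B (X \<omega>) + U \<omega> * indicator B (X \<omega>)) / (2 + u) \<partial>M)"
    by (simp add: w_def algebra_simps)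
  moreover have "integrable M (\<lambda>\<omega>. indicator B (X \<omega>) :: real)" "integrable M (\<lambda>\<omega>. U \<omega> * indicator B (X \<omega>))"
    using U by (auto intro!: integrable_const_bound[where B = 1] simp: indicator_def)
  ultimately have "(2 * (\<integral>\<omega>. indicator B (X \<omega>) \<partial>M) + (\<integral>\<omega>. U \<omega> * indicator B (X \<omega>) \<partial>M)) / (2 + u)
      = (\<integral>\<omega>. indicator B (X \<omega>) \<partial>M)"
    unfolding integral_divide_zero by (subst (asm) Bochner_Integration.integral_add) auto
  moreover have "2 + u \<noteq> 0" using \<open>\<bar>u\<bar> \<le> 1\<close> by linarith
  ultimately show ?thesis by (simp add: divide_eq_eq algebra_simps)
qed

text \<open>Real and imaginary parts are combinations of \<open>W\<close> and its conjugate. The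
  factorization for the conjugate is the conjugate of the hypothesis at frequency -t.\<close>

lemma (in prob_space) complex_weight_factor_char:
  fixes W :: "'a \<Rightarrow> complex" and X :: "'a \<Rightarrow> real"
  assumes [measurable]: "W \<in> borel_measurable M" "X \<in> borel_measurable M"
    and W: "\<And>\<omega>. norm (W \<omega>) \<le> 1"
    and fac: "\<And>t. (\<integral>\<omega>. W \<omega> * iexp (t * X \<omega>) \<partial>M) = w * (\<integral>\<omega>. iexp (t * X \<omega>) \<partial>M)"
    and B [measurable]: "B \<in> sets borel"
  shows "(\<integral>\<omega>. W \<omega> * indicator B (X \<omega>) \<partial>M) = w * (\<integral>\<omega>. indicator B (X \<omega>) \<partial>M)"
proof -
  have [measurable]: "(\<lambda>\<omega>. cnj (W \<omega>)) \<in> borel_measurable M"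
    by (intro borel_measurable_continuous_on[OF _ assms(1)] continuous_intros)
  have intW: "integrable M (\<lambda>\<omega>. W \<omega> * iexp (t * X \<omega>))" "integrable M (\<lambda>\<omega>. cnj (W \<omega>) * iexp (t * X \<omega>))" for t
    using W by (auto intro!: integrable_const_bound[where B = 1] simp: norm_mult)
  have cnj: "(\<integral>\<omega>. cnj (W \<omega>) * iexp (t * X \<omega>) \<partial>M) = cnj w * (\<integral>\<omega>. iexp (t * X \<omega>) \<partial>M)" for t
  proof -
    have "(\<integral>\<omega>. cnj (W \<omega>) * iexp (t * X \<omega>) \<partial>M) = (\<integral>\<omega>. cnj (W \<omega> * iexp (- t * X \<omega>)) \<partial>M)"
      by (simp add: exp_cnj)
    also have "\<dots> = cnj (w * (\<integral>\<omega>. iexp (- t * X \<omega>) \<partial>M))"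
      by (simp only: Bochner_Integration.integral_cnj fac)
    also have "\<dots> = cnj w * (\<integral>\<omega>. cnj (iexp (- t * X \<omega>)) \<partial>M)"
      by (simp only: Bochner_Integration.integral_cnj complex_cnj_mult)
    also have "\<dots> = cnj w * (\<integral>\<omega>. iexp (t * X \<omega>) \<partial>M)"
      by (simp add: exp_cnj)
    finally show ?thesis .
  qed
  have re: "(\<integral>\<omega>. Re (W \<omega>) * indicator B (X \<omega>) \<partial>M) = Re w * (\<integral>\<omega>. indicator B (X \<omega>) \<partial>M)"
  proof (rule real_weight_factor_char)
    fix t
    have "(\<integral>\<omega>. of_real (Re (W \<omega>)) * iexp (t * X \<omega>) \<partial>M) =
        (\<integral>\<omega>. (W \<omega> * iexp (t * X \<omega>) + cnj (W \<omega>) * iexp (t * X \<omega>)) / 2 \<partial>M)"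
      by (intro Bochner_Integration.integral_cong) (auto simp: complex_eq_iff algebra_simps)
    also have "\<dots> = (w + cnj w) / 2 * (\<integral>\<omega>. iexp (t * X \<omega>) \<partial>M)"
      using intW[of t] by (simp add: fac cnj algebra_simps add_divide_distrib del: of_real_mult)
    also have "(w + cnj w) / 2 = of_real (Re w)" by (simp add: complex_eq_iff)
    finally show "(\<integral>\<omega>. of_real (Re (W \<omega>)) * iexp (t * X \<omega>) \<partial>M) = of_real (Re w) * (\<integral>\<omega>. iexp (t * X \<omega>) \<partial>M)" .
  qed (use W abs_Re_le_cmod order_trans B in \<open>auto intro: order_trans\<close>)
  have im: "(\<integral>\<omega>. Im (W \<omega>) * indicator B (X \<omega>) \<partial>M) = Im w * (\<integral>\<omega>. indicator B (X \<omega>) \<partial>M)"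
  proof (rule real_weight_factor_char)
    fix t
    have "(\<integral>\<omega>. of_real (Im (W \<omega>)) * iexp (t * X \<omega>) \<partial>M) =
        (\<integral>\<omega>. (W \<omega> * iexp (t * X \<omega>) - cnj (W \<omega>) * iexp (t * X \<omega>)) / (2 * \<i>) \<partial>M)"
      by (intro Bochner_Integration.integral_cong) (auto simp: complex_eq_iff Re_divide Im_divide power2_eq_square algebra_simps)
    also have "\<dots> = (w - cnj w) / (2 * \<i>) * (\<integral>\<omega>. iexp (t * X \<omega>) \<partial>M)"
      using intW[of t] by (simp add: fac cnj algebra_simps diff_divide_distrib del: of_real_mult)
    also have "(w - cnj w) / (2 * \<i>) = of_real (Im w)" by (simp add: complex_eq_iff Re_divide Im_divide power2_eq_square)
    finally show "(\<integral>\<omega>. of_real (Im (W \<omega>)) * iexp (t * X \<omega>) \<partial>M) = of_real (Im w) * (\<integral>\<omega>. iexp (t * X \<omega>) \<partial>M)" .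
  qed (use W abs_Im_le_cmod order_trans B in \<open>auto intro: order_trans\<close>)
  have int: "integrable M (\<lambda>\<omega>. W \<omega> * indicator B (X \<omega>))"
    using W by (intro integrable_const_bound[where B = 1]) (auto simp: indicator_def)
  have "(\<integral>\<omega>. indicator B (X \<omega>) \<partial>M) = complex_of_real (\<integral>\<omega>. indicator B (X \<omega>) \<partial>M)"
    by (subst integral_complex_of_real[symmetric]) (simp only: of_real_indicator)
  moreover have "Re (\<integral>\<omega>. W \<omega> * indicator B (X \<omega>) \<partial>M) = (\<integral>\<omega>. Re (W \<omega>) * indicator B (X \<omega>) \<partial>M)"
    by (subst integral_Re[OF int, symmetric]) (auto intro!: Bochner_Integration.integral_cong simp: indicator_def)
  moreover have "Im (\<integral>\<omega>. W \<omega> * indicator B (X \<omega>) \<partial>M) = (\<integral>\<omega>. Im (W \<omega>) * indicator B (X \<omega>) \<partial>M)"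
    by (subst integral_Im[OF int, symmetric]) (auto intro!: Bochner_Integration.integral_cong simp: indicator_def)
  ultimately show ?thesis using re im by (simp add: complex_eq_iff)
qed

text \<open>Kac's theorem. The exponentials are replaced by indicators one coordinate at a time, treating
  the remaining factors as a bounded weight.\<close>

theorem (in prob_space) indep_vars_if_char_factors:
  fixes X :: "'i \<Rightarrow> 'a \<Rightarrow> real"
  assumes "finite I" and X [measurable]: "\<And>i. i \<in> I \<Longrightarrow> X i \<in> borel_measurable M"
    and fac: "\<And>u. (\<integral>\<omega>. (\<Prod>i\<in>I. iexp (u i * X i \<omega>)) \<partial>M) = (\<Prod>i\<in>I. \<integral>\<omega>. iexp (u i * X i \<omega>) \<partial>M)"
  shows "indep_vars (\<lambda>_. borel) X I"
proof -
  have claim: "(\<integral>\<omega>. (\<Prod>j\<in>J. indicator (B j) (X j \<omega>)) * (\<Prod>i\<in>I - J. iexp (u i * X i \<omega>)) \<partial>M) =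
      (\<Prod>j\<in>J. \<integral>\<omega>. indicator (B j) (X j \<omega>) \<partial>M) * (\<Prod>i\<in>I - J. \<integral>\<omega>. iexp (u i * X i \<omega>) \<partial>M)"
    if "finite J" "J \<subseteq> I" "\<And>j. j \<in> J \<Longrightarrow> B j \<in> sets borel" for J B u
    using that
  \<comment> \<open>\<open>u\<close> is generalized because the step for \<open>k\<close> needs the
    factorization with every frequency t in place of \<open>u k\<close>.\<close>
  proof (induction J arbitrary: u)
    case empty
    then show ?case using fac by simp
  next
    case (insert k J)
    let ?K = "I - insert k J"
    let ?W = "\<lambda>\<omega>. (\<Prod>j\<in>J. indicator (B j) (X j \<omega>)) * (\<Prod>i\<in>?K. iexp (u i * X i \<omega>)) :: complex"
    let ?w = "(\<Prod>j\<in>J. \<integral>\<omega>. indicator (B j) (X j \<omega>) \<partial>M) * (\<Prod>i\<in>?K. \<integral>\<omega>. iexp (u i * X i \<omega>) \<partial>M)"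
    have k: "I - J = insert k ?K" "finite ?K" "k \<notin> ?K"
      using insert.hyps insert.prems assms(1) by auto
    have [measurable]: "j \<in> insert k J \<Longrightarrow> B j \<in> sets borel" "j \<in> insert k J \<Longrightarrow> X j \<in> borel_measurable M" for j
      using insert.prems X by auto
    have "(\<integral>\<omega>. ?W \<omega> * indicator (B k) (X k \<omega>) \<partial>M) = ?w * (\<integral>\<omega>. indicator (B k) (X k \<omega>) \<partial>M)"
    proof (rule complex_weight_factor_char)
      show "?W \<in> borel_measurable M" "X k \<in> borel_measurable M" "B k \<in> sets borel"
        by (measurable; simp)+
      show "norm (?W \<omega>) \<le> 1" for \<omega>
      proof -
        have "norm (\<Prod>j\<in>J. indicator (B j) (X j \<omega>) :: complex) \<le> 1"
          unfolding prod_norm[symmetric] by (intro prod_le_1) (auto simp: indicator_def)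
        moreover have "norm (\<Prod>i\<in>?K. iexp (u i * X i \<omega>)) = 1"
          unfolding prod_norm[symmetric] by simp
        ultimately show ?thesis by (simp add: norm_mult)
      qed
      fix t
      have cong: "(\<Prod>i\<in>?K. iexp ((u(k := t)) i * X i \<omega>)) = (\<Prod>i\<in>?K. iexp (u i * X i \<omega>))"
        "(\<Prod>i\<in>?K. \<integral>\<omega>. iexp ((u(k := t)) i * X i \<omega>) \<partial>M) = (\<Prod>i\<in>?K. \<integral>\<omega>. iexp (u i * X i \<omega>) \<partial>M)" for \<omega>
        by (auto intro!: prod.cong)
      show "(\<integral>\<omega>. ?W \<omega> * iexp (t * X k \<omega>) \<partial>M) = ?w * (\<integral>\<omega>. iexp (t * X k \<omega>) \<partial>M)"
        using insert.IH[of "u(k := t)"] insert.prems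
        unfolding k(1) prod.insert[OF k(2,3)] cong by (simp add: mult_ac)
    qed
    then show ?case
      unfolding prod.insert[OF insert.hyps] by (simp add: mult_ac)
  qed
  have prod_prob: "prob (\<Inter>j\<in>J. X j -` B j \<inter> space M) = (\<Prod>j\<in>J. prob (X j -` B j \<inter> space M))"
    if J: "finite J" "J \<subseteq> I" "J \<noteq> {}" and [measurable]: "\<And>j. j \<in> J \<Longrightarrow> B j \<in> sets borel" for J B
  proof -
    have ind: "(\<integral>\<omega>. indicator (B j) (X j \<omega>) \<partial>M) = complex_of_real (prob (X j -` B j \<inter> space M))" if "j \<in> J" for j
    proof -
      have [measurable]: "X j \<in> borel_measurable M" "B j \<in> sets borel" using that J by auto
      have "(\<integral>\<omega>. indicator (B j) (X j \<omega>) \<partial>M) = (\<integral>\<omega>. complex_of_real (indicator (X j -` B j \<inter> space M) \<omega>) \<partial>M)"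
        by (intro Bochner_Integration.integral_cong) (auto simp: indicator_def)
      also have "\<dots> = of_real (prob (X j -` B j \<inter> space M))"
        unfolding integral_complex_of_real by simp
      finally show ?thesis .
    qed
    have ev: "(\<Inter>j\<in>J. X j -` B j \<inter> space M) \<in> events"
      using J X that(4) by (intro sets.finite_INT) (auto intro!: measurable_sets[where A = borel])
    have "complex_of_real (prob (\<Inter>j\<in>J. X j -` B j \<inter> space M)) =
      (\<integral>\<omega>. complex_of_real (indicator (\<Inter>j\<in>J. X j -` B j \<inter> space M) \<omega>) \<partial>M)"
      unfolding integral_complex_of_real using ev by simp
    \<comment> \<open>Frequency 0 erases the coordinates outside \<open>J\<close>.\<close>
    also have "\<dots> = (\<integral>\<omega>. (\<Prod>j\<in>J. indicator (B j) (X j \<omega>)) * (\<Prod>i\<in>I - J. iexp (0 * X i \<omega>)) \<partial>M)"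
    proof (intro Bochner_Integration.integral_cong refl)
      fix \<omega> assume "\<omega> \<in> space M"
      then have "indicator (\<Inter>j\<in>J. X j -` B j \<inter> space M) \<omega> = (\<Prod>j\<in>J. indicator (B j) (X j \<omega>) :: real)"
        using J by (auto simp: indicator_def prod_zero_iff)
      then show "complex_of_real (indicator (\<Inter>j\<in>J. X j -` B j \<inter> space M) \<omega>) =
          (\<Prod>j\<in>J. indicator (B j) (X j \<omega>)) * (\<Prod>i\<in>I - J. iexp (0 * X i \<omega>))"
        by (simp add: of_real_indicator)
    qed
    also have "\<dots> = complex_of_real (\<Prod>j\<in>J. prob (X j -` B j \<inter> space M))"
      using claim[of J B "\<lambda>_. 0"] J that(4) ind by (simp add: prob_space cong: prod.cong)
    finally show ?thesis by (simp only: of_real_eq_iff)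
  qed
  show ?thesis
    unfolding indep_vars_def2
  proof (intro conjI indep_setsI)
    show "\<forall>i\<in>I. random_variable borel (X i)" by simp
    show "{X i -` A \<inter> space M |A. A \<in> sets borel} \<subseteq> events" if "i \<in> I" for i
      using that by auto
    fix A J assume J: "J \<noteq> {}" "J \<subseteq> I" "finite J"
      and "\<forall>j\<in>J. A j \<in> {X j -` A \<inter> space M |A. A \<in> sets borel}"
    then have "\<forall>j\<in>J. \<exists>B. A j = X j -` B \<inter> space M \<and> B \<in> sets borel" by auto
    then obtain B where B: "\<And>j. j \<in> J \<Longrightarrow> A j = X j -` B j \<inter> space M" "\<And>j. j \<in> J \<Longrightarrow> B j \<in> sets borel"
      by metis
    show "prob (\<Inter>j\<in>J. A j) = (\<Prod>j\<in>J. prob (A j))"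
      using prod_prob[OF J(3,2,1), of B] B by (simp cong: INF_cong prod.cong)
  qed
qed

text \<open>With probabilities 0 and 1 the count is deterministic. Pointwise, a function of a random
  count is therefore \<open>pois_binom\<close> at random indicators.\<close>

lemma pois_binom_indicator:
  assumes "finite I"
  shows "pois_binom f (\<lambda>i. if P i then 1 else 0) I = f (card {i\<in>I. P i})"
  using assms
proof (induction I arbitrary: f)
  case (insert i I)
  have "{j\<in>insert i I. P j} = (if P i then insert i {j\<in>I. P j} else {j\<in>I. P j})" by auto
  then show ?case using insert by (simp add: pois_binom_insert)
qed simp

text \<open>\<open>pois_binom\<close> is affine in each probability separately, so independence
  carries the expectation from the indicators to their probabilities.\<close>

lemma (in prob_space) expectation_pois_binom_indicators:
  assumes "finite I" and indep: "indep_vars N X I" and C: "\<And>i. i \<in> I \<Longrightarrow> C i \<in> sets (N i)"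
  shows "(\<integral>\<omega>. pois_binom f (\<lambda>i. if X i \<omega> \<in> C i then 1 else 0) I \<partial>M) =
    pois_binom f (\<lambda>i. prob (X i -` C i \<inter> space M)) I"
    and "integrable M (\<lambda>\<omega>. pois_binom f (\<lambda>i. if X i \<omega> \<in> C i then 1 else 0) I)"
proof -
  have X: "X i \<in> measurable M (N i)" if "i \<in> I" for i
    using indep that by (auto simp: indep_vars_def)
  let ?p = "\<lambda>\<omega> i. if X i \<omega> \<in> C i then 1 else 0 :: real"
  let ?t = "\<lambda>S \<omega>. (\<Prod>i\<in>S. ?p \<omega> i) * (\<Prod>i\<in>I - S. 1 - ?p \<omega> i)"
  have tm: "integrable M (?t S) \<and> (\<integral>\<omega>. ?t S \<omega> \<partial>M) =
      (\<Prod>i\<in>S. prob (X i -` C i \<inter> space M)) * (\<Prod>i\<in>I - S. 1 - prob (X i -` C i \<inter> space M))"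
    if S: "S \<subseteq> I" for S
  proof (cases "I = {}")
    case True
    then show ?thesis using S by (simp add: prob_space)
  next
    case False
    \<comment> \<open>One summand is the indicator of the event that exactly the variables in
      \<open>S\<close> succeed; \<open>D\<close> writes it as a single intersection, to which
      independence applies.\<close>
    define D where "D i = (if i \<in> S then C i else space (N i) - C i)" for i
    have D: "D i \<in> sets (N i)" if "i \<in> I" for i using C that by (auto simp: D_def)
    let ?E = "\<Inter>i\<in>I. X i -` D i \<inter> space M"
    have split: "(\<Prod>i\<in>I. h i) = (\<Prod>i\<in>S. h i) * (\<Prod>i\<in>I - S. h i)" for h :: "_ \<Rightarrow> real"
      using prod.subset_diff[OF S \<open>finite I\<close>, of h] by (simp add: mult.commute)
    have ev: "?E \<in> events"
      using \<open>finite I\<close> False X D by (intro sets.finite_INT measurable_sets) auto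
    have t: "?t S \<omega> = indicator ?E \<omega>" if "\<omega> \<in> space M" for \<omega>
    proof -
      have "?t S \<omega> = (\<Prod>i\<in>S. if X i \<omega> \<in> D i then 1 else 0) * (\<Prod>i\<in>I - S. if X i \<omega> \<in> D i then 1 else 0)"
        using S X that by (intro arg_cong2[of _ _ _ _ "(*)"] prod.cong) (auto simp: D_def measurable_def Pi_def)
      also have "\<dots> = (\<Prod>i\<in>I. if X i \<omega> \<in> D i then 1 else 0)" by (simp only: split)
      also have "\<dots> = indicator ?E \<omega>"
        using that \<open>finite I\<close> False by (auto simp: indicator_def prod_zero_iff)
      finally show ?thesis .
    qed
    have "integrable M (indicator ?E :: _ \<Rightarrow> real)"
      by (rule integrable_real_indicator[OF ev]) (simp add: emeasure_eq_measure)
    then have "integrable M (?t S)"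
      using t by (subst Bochner_Integration.integrable_cong[OF refl, of M _ "indicator ?E"]) auto
    moreover have "(\<integral>\<omega>. ?t S \<omega> \<partial>M) = prob ?E"
      using t ev by (subst Bochner_Integration.integral_cong[OF refl, of M _ "indicator ?E"]) auto
    moreover have "prob ?E = (\<Prod>i\<in>I. prob (X i -` D i \<inter> space M))"
      using indep_varsD[OF indep False \<open>finite I\<close>] D by blast
    moreover have "(\<Prod>i\<in>I. prob (X i -` D i \<inter> space M)) =
      (\<Prod>i\<in>S. prob (X i -` C i \<inter> space M)) * (\<Prod>i\<in>I - S. 1 - prob (X i -` C i \<inter> space M))"
      unfolding split
    proof (intro arg_cong2[of _ _ _ _ "(*)"] prod.cong refl)
      fix i assume i: "i \<in> I - S"
      have "X i -` D i \<inter> space M = space M - (X i -` C i \<inter> space M)"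
        using i X[of i] by (auto simp: D_def measurable_def Pi_def)
      then show "prob (X i -` D i \<inter> space M) = 1 - prob (X i -` C i \<inter> space M)"
        using i X C by (simp add: prob_compl measurable_sets)
    qed (simp add: D_def)
    ultimately show ?thesis by simp
  qed
  show "(\<integral>\<omega>. pois_binom f (?p \<omega>) I \<partial>M) = pois_binom f (\<lambda>i. prob (X i -` C i \<inter> space M)) I"
    unfolding pois_binom_def using tm
    by (subst Bochner_Integration.integral_sum) (auto intro!: sum.cong)
  show "integrable M (\<lambda>\<omega>. pois_binom f (?p \<omega>) I)"
    unfolding pois_binom_def using tm by (intro Bochner_Integration.integrable_sum integrable_mult_left) auto
qed

text \<open>The level t is the supremum of those with mean count at least d; Markov's inequality
  bounds them, as d >= 1. Nothing is claimed at s = t, where the mean count may jump; a single level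
  has measure zero.\<close>

lemma (in prob_space) exists_tail_sum_threshold:
  fixes a :: "'i \<Rightarrow> 'a \<Rightarrow> real"
  assumes "0 < d" "\<And>i \<omega>. i \<in> R \<Longrightarrow> 0 \<le> a i \<omega>" "\<And>i. i \<in> R \<Longrightarrow> integrable M (a i)"
  obtains t where "0 \<le> t"
    and "\<And>s. 0 \<le> s \<Longrightarrow> s < t \<Longrightarrow> real d \<le> (\<Sum>i\<in>R. prob {\<omega>\<in>space M. s < a i \<omega>})"
    and "\<And>s. t < s \<Longrightarrow> (\<Sum>i\<in>R. prob {\<omega>\<in>space M. s < a i \<omega>}) \<le> real d"
proof -
  let ?m = "\<lambda>s. \<Sum>i\<in>R. prob {\<omega>\<in>space M. s < a i \<omega>}"
  have [measurable]: "i \<in> R \<Longrightarrow> a i \<in> borel_measurable M" for i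
    using assms(3) by auto
  have anti: "?m s' \<le> ?m s" if "s \<le> s'" for s s'
    using that by (intro sum_mono finite_measure_mono) auto
  \<comment> \<open>0 is inserted so that the supremum exists, and equals 0, when the mean count
    stays below d at all levels s >= 0.\<close>
  define T where "T = insert 0 {s. 0 \<le> s \<and> real d \<le> ?m s}"
  have "s \<le> (\<Sum>i\<in>R. \<integral>\<omega>. a i \<omega> \<partial>M)" if "s \<in> T" for s
  proof (cases "s = 0")
    case True
    then show ?thesis using assms(2) by (auto intro!: sum_nonneg Bochner_Integration.integral_nonneg)
  next
    case False
    then have s: "0 < s" "real d \<le> ?m s" using that by (auto simp: T_def)
    have "s = s * 1" by simp
    also have "\<dots> \<le> s * ?m s" using s \<open>0 < d\<close> by (intro mult_left_mono) auto
    also have "\<dots> = (\<Sum>i\<in>R. s * prob {\<omega>\<in>space M. s < a i \<omega>})" by (rule sum_distrib_left)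
    also have "\<dots> \<le> (\<Sum>i\<in>R. \<integral>\<omega>. a i \<omega> \<partial>M)"
    proof (rule sum_mono)
      fix i assume i: "i \<in> R"
      have "s * prob {\<omega>\<in>space M. s < a i \<omega>} = (\<integral>\<omega>. s * indicator {\<omega>\<in>space M. s < a i \<omega>} \<omega> \<partial>M)"
        using i by simp
      also have "\<dots> \<le> (\<integral>\<omega>. a i \<omega> \<partial>M)"
      proof (rule integral_mono)
        show "integrable M (\<lambda>\<omega>. s * indicator {\<omega>\<in>space M. s < a i \<omega>} \<omega>)"
          using i by (intro integrable_mult_right integrable_real_indicator)
            (auto simp: emeasure_eq_measure)
      qed (use assms(2)[OF i] assms(3)[OF i] in \<open>auto simp: indicator_def\<close>)
      finally show "s * prob {\<omega>\<in>space M. s < a i \<omega>} \<le> (\<integral>\<omega>. a i \<omega> \<partial>M)" .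
    qed
    finally show ?thesis .
  qed
  then have bdd: "bdd_above T" by (rule bdd_aboveI)
  show ?thesis
  proof (rule that[of "Sup T"])
    show "0 \<le> Sup T" using bdd by (intro cSup_upper) (auto simp: T_def)
    fix s
    show "real d \<le> ?m s" if "0 \<le> s" "s < Sup T"
    proof -
      obtain s' where "s' \<in> T" "s < s'"
        using \<open>s < Sup T\<close> less_cSup_iff[OF _ bdd] by (auto simp: T_def)
      then show ?thesis using anti[of s s'] that by (auto simp: T_def)
    qed
    show "?m s \<le> real d" if "Sup T < s"
    proof (rule ccontr)
      assume "\<not> ?m s \<le> real d"
      moreover have "0 \<le> Sup T" using bdd by (intro cSup_upper) (auto simp: T_def)
      ultimately have "s \<in> T" using that by (auto simp: T_def)
      then show False using that cSup_upper[OF _ bdd] by fastforce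
    qed
  qed
qed

text \<open>The layer at level \<open>s\<close> contributes \<open>E min(d, N\<^sub>s)\<close> to the expectation, where \<open>N\<^sub>s\<close> counts
  independent exceedances and has mean \<open>m s\<close>. Integrating the correlation gap
  \<open>c * min(d, m s)\<close> over the levels below and above the crossing point \<open>t\<close> of \<open>m\<close> with \<open>d\<close>
  gives the two parts of the bound.\<close>

lemma (in prob_space) expectation_Top_indep_ge:
  fixes a :: "'i \<Rightarrow> 'a \<Rightarrow> real"
  assumes "finite I" "R \<subseteq> I" "0 < d" "d \<le> card R" "0 \<le> c_const d (card R)"
    and nonneg: "\<And>i \<omega>. i \<in> I \<Longrightarrow> 0 \<le> a i \<omega>"
    and int: "\<And>i. i \<in> I \<Longrightarrow> integrable M (a i)"
    and indep: "indep_vars (\<lambda>_. borel) a R"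
  obtains t where "0 \<le> t"
    and "c_const d (card R) * (real d * t + (\<Sum>i\<in>R. \<integral>\<omega>. max 0 (a i \<omega> - t) \<partial>M))
      \<le> (\<integral>\<omega>. Top d I (\<lambda>i. a i \<omega>) \<partial>M)"
proof -
  let ?c = "c_const d (card R)"
  let ?m = "\<lambda>s. \<Sum>i\<in>R. prob {\<omega>\<in>space M. s < a i \<omega>}"
  have R: "finite R" using assms(1,2) finite_subset by blast
  have dI: "d \<le> card I" using assms(1,2,4) card_mono[of I R] by linarith
  have [measurable]: "i \<in> I \<Longrightarrow> a i \<in> borel_measurable M" "i \<in> R \<Longrightarrow> a i \<in> borel_measurable M" for i
    using int assms(2) by auto
  obtain t where t: "0 \<le> t" "\<And>s. 0 \<le> s \<Longrightarrow> s < t \<Longrightarrow> real d \<le> ?m s" "\<And>s. t < s \<Longrightarrow> ?m s \<le> real d"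
    by (rule exists_tail_sum_threshold[of d R a]) (use assms(2,3) nonneg int in auto)
  interpret pair_sigma_finite M lborel ..
  have intTop: "integrable M (\<lambda>\<omega>. Top d I (\<lambda>i. a i \<omega>))"
  proof (rule Bochner_Integration.integrable_bound)
    show "integrable M (\<lambda>\<omega>. \<Sum>i\<in>I. a i \<omega>)" using int by simp
    show "(\<lambda>\<omega>. Top d I (\<lambda>i. a i \<omega>)) \<in> borel_measurable M"
      using assms(1) dI nonneg by (intro borel_measurable_Top) auto
    show "AE \<omega> in M. norm (Top d I (\<lambda>i. a i \<omega>)) \<le> norm (\<Sum>i\<in>I. a i \<omega>)"
      using assms(1) dI nonneg by (intro AE_I2) (simp add: Top_le_sum Top_nonneg sum_nonneg)
  qed
  have intmax: "integrable M (\<lambda>\<omega>. max 0 (a i \<omega> - t))" if "i \<in> R" for i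
    using int[of i] that assms(2) by (intro integrable_max) auto
  have layer: "(\<integral>\<^sup>+\<omega>. ennreal (min (real d) (exceedances R (\<lambda>i. a i \<omega>) s)) \<partial>M) \<ge> ennreal (?c * min (real d) (?m s))" for s
  proof -
    let ?f = "\<lambda>k. min (real d) (real k)"
    let ?N = "\<lambda>\<omega>. pois_binom ?f (\<lambda>i. if a i \<omega> \<in> {s<..} then 1 else 0) R"
    have N: "min (real d) (exceedances R (\<lambda>i. a i \<omega>) s) = ?N \<omega>" for \<omega>
      using R by (simp add: pois_binom_indicator exceedances_def sum.If_cases Int_def)
    have E: "(\<integral>\<omega>. ?N \<omega> \<partial>M) = pois_binom ?f (\<lambda>i. prob (a i -` {s<..} \<inter> space M)) R" "integrable M ?N"
      using expectation_pois_binom_indicators[OF R indep, of "\<lambda>_. {s<..}" ?f] by auto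
    have p: "prob (a i -` {s<..} \<inter> space M) = prob {\<omega>\<in>space M. s < a i \<omega>}" for i
      by (intro arg_cong[of _ _ prob]) auto
    have "?c * min (real d) (?m s) \<le> (\<integral>\<omega>. ?N \<omega> \<partial>M)"
      unfolding E p using assms(3,4) R by (intro pois_binom_min_ge) auto
    then have "ennreal (?c * min (real d) (?m s)) \<le> ennreal (\<integral>\<omega>. ?N \<omega> \<partial>M)"
      by (rule ennreal_leI)
    also have "\<dots> = (\<integral>\<^sup>+\<omega>. ennreal (?N \<omega>) \<partial>M)"
      using E(2) by (intro nn_integral_eq_integral[symmetric]) (auto simp: pois_binom_indicator[OF R])
    finally show ?thesis by (simp only: N)
  qed
  have tail: "(\<integral>\<^sup>+s. ennreal (prob {\<omega>\<in>space M. s < a i \<omega>}) * indicator {t<..} s \<partial>lborel) =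
      ennreal (\<integral>\<omega>. max 0 (a i \<omega> - t) \<partial>M)" if i: "i \<in> R" for i
  proof -
    have "(\<integral>\<^sup>+s. ennreal (prob {\<omega>\<in>space M. s < a i \<omega>}) * indicator {t<..} s \<partial>lborel) =
        (\<integral>\<^sup>+s. \<integral>\<^sup>+\<omega>. indicator {t<..<a i \<omega>} s \<partial>M \<partial>lborel)"
    proof (rule nn_integral_cong)
      fix s
      have "(\<integral>\<^sup>+\<omega>. indicator {t<..<a i \<omega>} s \<partial>M) =
          (\<integral>\<^sup>+\<omega>. indicator {\<omega>\<in>space M. s < a i \<omega>} \<omega> * indicator {t<..} s \<partial>M)"
        by (intro nn_integral_cong) (auto simp: indicator_def)
      also have "\<dots> = ennreal (prob {\<omega>\<in>space M. s < a i \<omega>}) * indicator {t<..} s"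
        using i by (simp add: nn_integral_multc emeasure_eq_measure)
      finally show "ennreal (prob {\<omega>\<in>space M. s < a i \<omega>}) * indicator {t<..} s =
          (\<integral>\<^sup>+\<omega>. indicator {t<..<a i \<omega>} s \<partial>M)" ..
    qed
    also have "\<dots> = (\<integral>\<^sup>+\<omega>. \<integral>\<^sup>+s. indicator {t<..<a i \<omega>} s \<partial>lborel \<partial>M)"
    proof (rule Fubini')
      have "(\<lambda>(\<omega>, s). indicator {t<..<a i \<omega>} s :: ennreal) = (\<lambda>(\<omega>, s). if t < s \<and> s < a i \<omega> then 1 else 0)"
        by (auto simp: fun_eq_iff indicator_def)
      also have "\<dots> \<in> borel_measurable (M \<Otimes>\<^sub>M lborel)" using i by measurable
      finally show "(\<lambda>(\<omega>, s). indicator {t<..<a i \<omega>} s :: ennreal) \<in> borel_measurable (M \<Otimes>\<^sub>M lborel)" .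
    qed
    also have "\<dots> = (\<integral>\<^sup>+\<omega>. ennreal (max 0 (a i \<omega> - t)) \<partial>M)"
    proof (rule nn_integral_cong)
      fix \<omega>
      show "(\<integral>\<^sup>+s. indicator {t<..<a i \<omega>} s \<partial>lborel) = ennreal (max 0 (a i \<omega> - t))"
        by (cases "t \<le> a i \<omega>") auto
    qed
    also have "\<dots> = ennreal (\<integral>\<omega>. max 0 (a i \<omega> - t) \<partial>M)"
      using intmax[OF i] by (intro nn_integral_eq_integral) auto
    finally show ?thesis .
  qed
  have "ennreal (?c * (real d * t + (\<Sum>i\<in>R. \<integral>\<omega>. max 0 (a i \<omega> - t) \<partial>M))) =
    ennreal ?c * (ennreal (real d) * ennreal t + (\<Sum>i\<in>R. ennreal (\<integral>\<omega>. max 0 (a i \<omega> - t) \<partial>M)))"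
  proof -
    have "0 \<le> (\<Sum>i\<in>R. \<integral>\<omega>. max 0 (a i \<omega> - t) \<partial>M)"
      by (intro sum_nonneg Bochner_Integration.integral_nonneg) auto
    then show ?thesis
      using assms(5) t(1) by (simp add: ennreal_mult ennreal_plus sum_ennreal)
  qed
  also have "\<dots> = ennreal ?c * ((\<integral>\<^sup>+s. ennreal (real d) * indicator {0..<t} s \<partial>lborel) +
      (\<Sum>i\<in>R. \<integral>\<^sup>+s. ennreal (prob {\<omega>\<in>space M. s < a i \<omega>}) * indicator {t<..} s \<partial>lborel))"
    using t(1) by (simp add: tail nn_integral_cmult)
  also have "\<dots> = (\<integral>\<^sup>+s. ennreal ?c * (ennreal (real d) * indicator {0..<t} s +
      (\<Sum>i\<in>R. ennreal (prob {\<omega>\<in>space M. s < a i \<omega>}) * indicator {t<..} s)) \<partial>lborel)"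
  proof -
    have [measurable]: "(\<lambda>s. ennreal (prob {\<omega>\<in>space M. s < a i \<omega>})) \<in> borel_measurable borel" if "i \<in> R" for i
    proof -
      have "(\<lambda>s. emeasure M {\<omega>\<in>space M. s < a i \<omega>}) \<in> borel_measurable borel"
        using that by measurable
      then show ?thesis by (simp add: emeasure_eq_measure)
    qed
    show ?thesis by (simp add: nn_integral_cmult nn_integral_add nn_integral_sum)
  qed
  also have "\<dots> \<le> (\<integral>\<^sup>+s. ennreal (?c * min (real d) (?m s)) * indicator {0..} s \<partial>lborel)"
  proof (rule nn_integral_mono)
    fix s
    have m0: "0 \<le> ?m s" by (intro sum_nonneg) auto
    have "ennreal (real d) * indicator {0..<t} s + (\<Sum>i\<in>R. ennreal (prob {\<omega>\<in>space M. s < a i \<omega>}) * indicator {t<..} s)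
        = ennreal (real d) * indicator {0..<t} s + ennreal (?m s) * indicator {t<..} s"
      by (simp add: sum_distrib_right[symmetric] sum_ennreal)
    also have "\<dots> \<le> ennreal (min (real d) (?m s)) * indicator {0..} s"
      using t(1) t(2,3)[of s] by (auto simp: indicator_def min_def)
    finally show "ennreal ?c * (ennreal (real d) * indicator {0..<t} s +
      (\<Sum>i\<in>R. ennreal (prob {\<omega>\<in>space M. s < a i \<omega>}) * indicator {t<..} s))
      \<le> ennreal (?c * min (real d) (?m s)) * indicator {0..} s"
      using assms(5) m0 by (simp add: ennreal_mult mult.assoc mult_left_mono)
  qed
  also have "\<dots> \<le> (\<integral>\<^sup>+s. (\<integral>\<^sup>+\<omega>. ennreal (min (real d) (exceedances R (\<lambda>i. a i \<omega>) s)) * indicator {0..} s \<partial>M) \<partial>lborel)"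
    using layer by (intro nn_integral_mono) (simp add: nn_integral_multc mult_right_mono)
  also have "\<dots> = (\<integral>\<^sup>+\<omega>. \<integral>\<^sup>+s. ennreal (min (real d) (exceedances R (\<lambda>i. a i \<omega>) s)) * indicator {0..} s \<partial>lborel \<partial>M)"
    by (rule Fubini') measurable
  \<comment> \<open>Indices outside \<open>R\<close> can only add exceedances, so \<open>Top\<close>
    over all of \<open>I\<close> dominates while the constant involves just
    \<open>card R\<close>.\<close>
  also have "\<dots> \<le> (\<integral>\<^sup>+\<omega>. ennreal (Top d I (\<lambda>i. a i \<omega>)) \<partial>M)"
  proof (rule nn_integral_mono)
    fix \<omega>
    have "(\<integral>\<^sup>+s. ennreal (min (real d) (exceedances R (\<lambda>i. a i \<omega>) s)) * indicator {0..} s \<partial>lborel)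
        \<le> (\<integral>\<^sup>+s. ennreal (min (real d) (exceedances I (\<lambda>i. a i \<omega>) s)) * indicator {0..} s \<partial>lborel)"
      using assms(1,2)
      by (intro nn_integral_mono mult_right_mono ennreal_leI min.mono exceedances_mono) auto
    then show "(\<integral>\<^sup>+s. ennreal (min (real d) (exceedances R (\<lambda>i. a i \<omega>) s)) * indicator {0..} s \<partial>lborel)
        \<le> ennreal (Top d I (\<lambda>i. a i \<omega>))"
      using Top_layer_cake[OF assms(1) dI, of "\<lambda>i. a i \<omega>"] nonneg by simp
  qed
  also have "\<dots> = ennreal (\<integral>\<omega>. Top d I (\<lambda>i. a i \<omega>) \<partial>M)"
    using intTop assms(1) dI nonneg by (intro nn_integral_eq_integral) (auto intro!: AE_I2 Top_nonneg)
  finally have "?c * (real d * t + (\<Sum>i\<in>R. \<integral>\<omega>. max 0 (a i \<omega> - t) \<partial>M)) \<le> (\<integral>\<omega>. Top d I (\<lambda>i. a i \<omega>) \<partial>M)"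
    using assms(1) dI nonneg by (subst (asm) ennreal_le_iff) (auto intro!: Bochner_Integration.integral_nonneg Top_nonneg)
  then show ?thesis using that t(1) by blast
qed

section \<open>Gaussian vectors\<close>

text \<open>Presents point mass and density alike as a rescaled standard normal law, so that
  degenerate directions are treated uniformly afterwards.\<close>

lemma centered_normal_eq_distr:
  assumes "0 \<le> s"
  shows "centered_normal s = distr std_normal_distribution borel (\<lambda>z. sqrt s * z)"
proof -
  interpret N: real_distribution std_normal_distribution by (rule real_dist_normal_dist)
  show ?thesis
  proof (cases "s = 0")
    case True
    then show ?thesis by (simp add: centered_normal_def N.distr_const[of 0 borel, simplified])
  next
    case False
    have "distributed std_normal_distribution lborel (\<lambda>z. z) std_normal_density"
      using distr_id2[of lborel std_normal_distribution] by (simp add: distributed_def)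
    from N.normal_density_affine[OF this, of "sqrt s" 0]
    have "distributed std_normal_distribution lborel (\<lambda>z. sqrt s * z) (normal_density 0 (sqrt s))"
      using False assms by simp
    then have "distr std_normal_distribution lborel (\<lambda>z. sqrt s * z) = density lborel (normal_density 0 (sqrt s))"
      by (simp add: distributed_def)
    then show ?thesis
      using False by (simp add: centered_normal_def cong: distr_cong)
  qed
qed

lemma distr_PiM_coordinatewise:
  assumes "finite I" and M: "\<And>i. prob_space (M i)"
    and f: "\<And>i. f i \<in> measurable (M i) (N i)"
  shows "distr (PiM I M) (PiM I N) (\<lambda>z. \<lambda>i\<in>I. f i (z i)) = PiM I (\<lambda>i. distr (M i) (N i) (f i))"
proof -
  interpret D: product_prob_space "\<lambda>i. distr (M i) (N i) (f i)" I
    by (intro product_prob_spaceI prob_space.prob_space_distr M f)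
  interpret P: product_prob_space M I
    by (intro product_prob_spaceI M)
  show ?thesis
  proof (rule D.PiM_eqI)
    show "sets (distr (PiM I M) (PiM I N) (\<lambda>z. \<lambda>i\<in>I. f i (z i))) = PiM I (\<lambda>i. distr (M i) (N i) (f i))"
      by (simp cong: sets_PiM_cong)
    fix A assume A: "\<And>i. i \<in> I \<Longrightarrow> A i \<in> sets (distr (M i) (N i) (f i))"
    have [measurable]: "(\<lambda>z. \<lambda>i\<in>I. f i (z i)) \<in> measurable (PiM I M) (PiM I N)"
      using f by (intro measurable_restrict) (auto intro: measurable_compose[OF measurable_component_singleton])
    have "emeasure (distr (PiM I M) (PiM I N) (\<lambda>z. \<lambda>i\<in>I. f i (z i))) (Pi\<^sub>E I A) =
        emeasure (PiM I M) ((\<lambda>z. \<lambda>i\<in>I. f i (z i)) -` Pi\<^sub>E I A \<inter> space (PiM I M))"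
      using A \<open>finite I\<close> by (intro emeasure_distr) (auto intro!: sets_PiM_I_finite)
    also have "(\<lambda>z. \<lambda>i\<in>I. f i (z i)) -` Pi\<^sub>E I A \<inter> space (PiM I M) =
        Pi\<^sub>E I (\<lambda>i. f i -` A i \<inter> space (M i))"
      by (auto simp: space_PiM PiE_iff)
    also have "emeasure (PiM I M) \<dots> = (\<Prod>i\<in>I. emeasure (M i) (f i -` A i \<inter> space (M i)))"
      using A f \<open>finite I\<close> by (intro P.emeasure_PiM) (auto intro: measurable_sets)
    also have "\<dots> = (\<Prod>i\<in>I. emeasure (distr (M i) (N i) (f i)) (A i))"
      using A f by (intro prod.cong) (auto simp: emeasure_distr)
    finally show "emeasure (distr (PiM I M) (PiM I N) (\<lambda>z. \<lambda>i\<in>I. f i (z i))) (Pi\<^sub>E I A) =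
        (\<Prod>i\<in>I. emeasure (distr (M i) (N i) (f i)) (A i))" .
  qed fact
qed

lemma char_centered_normal:
  assumes "0 \<le> s"
  shows "char (centered_normal s) t = of_real (exp (- (s * t\<^sup>2) / 2))"
proof -
  have "char (centered_normal s) t = (\<integral>z. iexp (t * (sqrt s * z)) \<partial>std_normal_distribution)"
    unfolding centered_normal_eq_distr[OF assms] char_def by (subst integral_distr) auto
  also have "\<dots> = char std_normal_distribution (sqrt s * t)"
    by (simp add: char_def mult_ac)
  finally show ?thesis
    using assms by (simp add: char_std_normal_distribution power_mult_distrib)
qed

context
  fixes M :: "'w measure" and g :: "'w \<Rightarrow> real^'p" and \<Sigma> :: "real^'p^'p"
  assumes prob: "prob_space M" and psd: "pos_semidef \<Sigma>" and gauss: "gaussian_vector M g \<Sigma>"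
begin

interpretation prob_space M by (rule prob)

lemma gaussian_vector_measurable [measurable]: "g \<in> borel_measurable M"
  using gauss by (simp add: gaussian_vector_def)

lemma gaussian_vector_distr:
  "distr M borel (\<lambda>\<omega>. u \<bullet> g \<omega>) =
    distr std_normal_distribution borel (\<lambda>z. sqrt (u \<bullet> (\<Sigma> *v u)) * z)"
  using gauss psd by (simp add: gaussian_vector_def pos_semidef_def centered_normal_eq_distr)

text \<open>The frequency is absorbed into \<open>u\<close>: the laws of all one-dimensional
  projections determine the joint characteristic function, as in the Cramer-Wold argument.\<close>

lemma gaussian_vector_char:
  "(\<integral>\<omega>. iexp (u \<bullet> g \<omega>) \<partial>M) = of_real (exp (- (u \<bullet> (\<Sigma> *v u)) / 2))"
proof -
  have "(\<integral>\<omega>. iexp (u \<bullet> g \<omega>) \<partial>M) = char (distr M borel (\<lambda>\<omega>. u \<bullet> g \<omega>)) 1"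
    unfolding char_def by (subst integral_distr) auto
  also have "\<dots> = char (centered_normal (u \<bullet> (\<Sigma> *v u))) 1"
    using gauss by (simp add: gaussian_vector_def)
  finally show ?thesis
    using psd by (simp add: char_centered_normal pos_semidef_def)
qed

lemma gaussian_vector_integral:
  fixes f :: "real \<Rightarrow> real"
  assumes [measurable]: "f \<in> borel_measurable borel"
  shows "(\<integral>\<omega>. f (u \<bullet> g \<omega>) \<partial>M) = (\<integral>z. f (sqrt (u \<bullet> (\<Sigma> *v u)) * z) \<partial>std_normal_distribution)"
    and "integrable M (\<lambda>\<omega>. f (u \<bullet> g \<omega>)) \<longleftrightarrow>
      integrable std_normal_distribution (\<lambda>z. f (sqrt (u \<bullet> (\<Sigma> *v u)) * z))"
proof -
  have "(\<integral>\<omega>. f (u \<bullet> g \<omega>) \<partial>M) = (\<integral>x. f x \<partial>distr M borel (\<lambda>\<omega>. u \<bullet> g \<omega>))"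
    by (subst integral_distr) auto
  also have "\<dots> = (\<integral>z. f (sqrt (u \<bullet> (\<Sigma> *v u)) * z) \<partial>std_normal_distribution)"
    unfolding gaussian_vector_distr by (subst integral_distr) auto
  finally show "(\<integral>\<omega>. f (u \<bullet> g \<omega>) \<partial>M) = (\<integral>z. f (sqrt (u \<bullet> (\<Sigma> *v u)) * z) \<partial>std_normal_distribution)" .
  have "integrable M (\<lambda>\<omega>. f (u \<bullet> g \<omega>)) \<longleftrightarrow> integrable (distr M borel (\<lambda>\<omega>. u \<bullet> g \<omega>)) f"
    by (subst integrable_distr_eq) auto
  also have "\<dots> \<longleftrightarrow> integrable std_normal_distribution (\<lambda>z. f (sqrt (u \<bullet> (\<Sigma> *v u)) * z))"
    unfolding gaussian_vector_distr by (subst integrable_distr_eq) auto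
  finally show "integrable M (\<lambda>\<omega>. f (u \<bullet> g \<omega>)) \<longleftrightarrow>
      integrable std_normal_distribution (\<lambda>z. f (sqrt (u \<bullet> (\<Sigma> *v u)) * z))" .
qed

lemma gaussian_vector_second_moment:
  "integrable M (\<lambda>\<omega>. (u \<bullet> g \<omega>)\<^sup>2)" "(\<integral>\<omega>. (u \<bullet> g \<omega>)\<^sup>2 \<partial>M) = u \<bullet> (\<Sigma> *v u)"
proof -
  have pos: "0 \<le> u \<bullet> (\<Sigma> *v u)" using psd by (simp add: pos_semidef_def)
  have std: "integrable std_normal_distribution (\<lambda>z. z\<^sup>2)" "(\<integral>z. z\<^sup>2 \<partial>std_normal_distribution) = 1"
    using std_normal_distribution_even_moments[of 1] by (simp_all add: eval_nat_numeral)
  show "integrable M (\<lambda>\<omega>. (u \<bullet> g \<omega>)\<^sup>2)" "(\<integral>\<omega>. (u \<bullet> g \<omega>)\<^sup>2 \<partial>M) = u \<bullet> (\<Sigma> *v u)"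
    using gaussian_vector_integral[of "\<lambda>x. x\<^sup>2" u] std pos by (simp_all add: power_mult_distrib)
qed

lemma integrable_Top_gaussian:
  fixes V :: "real^'p^'p"
  assumes "d \<le> CARD('p)"
  shows "integrable M (\<lambda>\<omega>. Top d UNIV (\<lambda>i. (column i V \<bullet> g \<omega>)\<^sup>2))"
proof (rule Bochner_Integration.integrable_bound)
  show "integrable M (\<lambda>\<omega>. \<Sum>i\<in>UNIV. (column i V \<bullet> g \<omega>)\<^sup>2)"
    using gaussian_vector_second_moment(1) by simp
  show "(\<lambda>\<omega>. Top d UNIV (\<lambda>i. (column i V \<bullet> g \<omega>)\<^sup>2)) \<in> borel_measurable M"
    using assms by (intro borel_measurable_Top) auto
  show "AE \<omega> in M. norm (Top d UNIV (\<lambda>i. (column i V \<bullet> g \<omega>)\<^sup>2)) \<le> norm (\<Sum>i\<in>UNIV. (column i V \<bullet> g \<omega>)\<^sup>2)"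
    using assms by (intro AE_I2) (simp add: Top_le_sum Top_nonneg sum_nonneg)
qed

lemma risk_le_trace:
  assumes "d \<le> CARD('p)" "orthogonal_matrix V"
  shows "risk d M g V \<le> trace \<Sigma>"
proof -
  have "risk d M g V \<le> (\<integral>\<omega>. (\<Sum>i\<in>UNIV. (column i V \<bullet> g \<omega>)\<^sup>2) \<partial>M)"
    unfolding risk_def using assms(1) gaussian_vector_second_moment(1) integrable_Top_gaussian
    by (intro integral_mono) (auto intro: Top_le_sum)
  also have "\<dots> = trace \<Sigma>"
    using gaussian_vector_second_moment by (simp add: trace_orthonormal_columns[OF assms(2)])
  finally show ?thesis .
qed

lemma bdd_above_risk:
  assumes "d \<le> CARD('p)"
  shows "bdd_above (risk d M g ` {V. orthogonal_matrix V})"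
  using risk_le_trace[OF assms] by (auto intro!: bdd_aboveI)

context
  fixes V :: "real^'p^'p" and l :: "'p \<Rightarrow> real"
  assumes V: "orthogonal_matrix V" and eig: "\<And>i. \<Sigma> *v column i V = l i *\<^sub>R column i V"
begin

lemma variance_eigenbasis: "column i V \<bullet> (\<Sigma> *v column i V) = l i"
  by (simp add: eig orthonormal_columns_inner[OF V])

lemma eigenvalue_nonneg: "0 \<le> l i"
  using psd variance_eigenbasis[of i] by (metis pos_semidef_def)

text \<open>The covariance is diagonal in an eigenbasis, so the variance of a combination of
  coordinates has no cross terms and the joint characteristic function factors. The injection
  \<open>h\<close> serves both plain indices and sorted positions.\<close>

lemma indep_vars_eigenbasis:
  assumes "finite I" "inj_on h I"
  shows "indep_vars (\<lambda>_. borel) (\<lambda>i \<omega>. column (h i) V \<bullet> g \<omega>) I"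
proof (rule indep_vars_if_char_factors)
  fix u
  define w where "w = (\<Sum>i\<in>I. u i *\<^sub>R column (h i) V)"
  have unit: "column (h i) V \<bullet> column (h j) V = (if i = j then 1 else 0)" if "i \<in> I" "j \<in> I" for i j
    using that assms(2) by (simp add: orthonormal_columns_inner[OF V] inj_on_eq_iff)
  have "w \<bullet> (\<Sigma> *v w) = (\<Sum>i\<in>I. u i * (\<Sum>j\<in>I. u j * l (h i) * (column (h j) V \<bullet> column (h i) V)))"
    by (simp add: w_def linear_sum[OF matrix_vector_mul_linear] matrix_vector_mult_scaleR eig
        inner_sum_left inner_sum_right sum_distrib_left mult_ac)
  also have "\<dots> = (\<Sum>i\<in>I. u i * (\<Sum>j\<in>I. if j = i then u j * l (h i) else 0))"
    by (intro sum.cong arg_cong2[of _ _ _ _ "(*)"] refl) (auto simp: unit)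
  also have "\<dots> = (\<Sum>i\<in>I. l (h i) * (u i)\<^sup>2)"
    using assms(1) by (intro sum.cong) (auto simp: power2_eq_square)
  finally have q: "w \<bullet> (\<Sigma> *v w) = (\<Sum>i\<in>I. l (h i) * (u i)\<^sup>2)" .
  have one: "(\<integral>\<omega>. iexp (u i * (column (h i) V \<bullet> g \<omega>)) \<partial>M) = of_real (exp (- (l (h i) * (u i)\<^sup>2) / 2))" for i
    using gaussian_vector_char[of "u i *\<^sub>R column (h i) V"]
    by (simp add: matrix_vector_mult_scaleR variance_eigenbasis power2_eq_square mult_ac)
  have "(\<integral>\<omega>. (\<Prod>i\<in>I. iexp (u i * (column (h i) V \<bullet> g \<omega>))) \<partial>M) = (\<integral>\<omega>. iexp (w \<bullet> g \<omega>) \<partial>M)"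
    using assms(1) by (simp add: exp_sum[symmetric] w_def inner_sum_left sum_distrib_left)
  also have "\<dots> = of_real (exp (- (\<Sum>i\<in>I. l (h i) * (u i)\<^sup>2) / 2))"
    by (simp only: gaussian_vector_char q)
  also have "\<dots> = (\<Prod>i\<in>I. of_real (exp (- (l (h i) * (u i)\<^sup>2) / 2)))"
    using assms(1) by (simp only: of_real_prod[symmetric] exp_sum[symmetric] sum_negf[symmetric] sum_divide_distrib)
  finally show "(\<integral>\<omega>. (\<Prod>i\<in>I. iexp (u i * (column (h i) V \<bullet> g \<omega>))) \<partial>M) =
      (\<Prod>i\<in>I. \<integral>\<omega>. iexp (u i * (column (h i) V \<bullet> g \<omega>)) \<partial>M)"
    by (simp only: one)
qed (use assms in auto)

text \<open>\<open>KL\<close> lives on a product space indexed by sorted positions,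
  \<open>risk\<close> on \<open>M\<close> with indices in \<open>'p\<close>. The sorting bijection
  \<pi> matches the indices, and independence identifies the two joint laws.\<close>

lemma KL_eq_risk_eigenbasis:
  assumes "d \<le> CARD('p)"
  shows "KL d \<Sigma> = risk d M g V"
proof -
  let ?n = "CARD('p)" and ?I = "{..<CARD('p)}"
  obtain \<pi> where \<pi>: "bij_betw \<pi> ?I (UNIV :: 'p set)"
    "\<And>j. j < ?n \<Longrightarrow> decr_rearrangement UNIV l ! j = l (\<pi> j)"
    "\<And>i j. i \<le> j \<Longrightarrow> j < ?n \<Longrightarrow> l (\<pi> j) \<le> l (\<pi> i)"
    using decr_rearrangement_enum[of "UNIV :: 'p set" l] by auto
  let ?Y = "\<lambda>j \<omega>. column (\<pi> j) V \<bullet> g \<omega>"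
  let ?B = "PiM ?I (\<lambda>_. borel :: real measure)"
  have [measurable]: "(\<lambda>y. Top d ?I (\<lambda>j. (y j)\<^sup>2)) \<in> borel_measurable ?B"
    using assms by (intro borel_measurable_Top) auto
  interpret N: real_distribution std_normal_distribution by (rule real_dist_normal_dist)
  have "distr M ?B (\<lambda>\<omega>. \<lambda>j\<in>?I. ?Y j \<omega>) = PiM ?I (\<lambda>j. distr M borel (?Y j))"
    using indep_vars_eigenbasis[OF _ bij_betw_imp_inj_on[OF \<pi>(1)]]
    by (subst indep_vars_iff_distr_eq_PiM'[symmetric]) (auto simp: lessThan_empty_iff)
  also have "\<dots> = PiM ?I (\<lambda>j. distr std_normal_distribution borel (\<lambda>z. sqrt (l (\<pi> j)) * z))"
    by (intro PiM_cong) (auto simp: gaussian_vector_distr variance_eigenbasis)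
  also have "\<dots> = distr (PiM ?I (\<lambda>_. std_normal_distribution)) ?B (\<lambda>z. \<lambda>j\<in>?I. sqrt (l (\<pi> j)) * z j)"
    by (rule distr_PiM_coordinatewise[symmetric]) (auto intro: N.prob_space_axioms)
  finally have law: "distr M ?B (\<lambda>\<omega>. \<lambda>j\<in>?I. ?Y j \<omega>) =
    distr (PiM ?I (\<lambda>_. std_normal_distribution)) ?B (\<lambda>z. \<lambda>j\<in>?I. sqrt (l (\<pi> j)) * z j)" .
  \<comment> \<open>Restricted functions are \<open>undefined\<close> outside the index set, and
    \<open>Top\<close> must be seen to ignore those values.\<close>
  have Top_cong: "Top d ?I a = Top d ?I b" if "\<And>j. j < ?n \<Longrightarrow> a j = b j" for a b
    unfolding Top_def decr_rearrangement_def using that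
    by (metis (mono_tags, lifting) image_mset_cong finite_lessThan elem_mset_set lessThan_iff)
  have "risk d M g V = (\<integral>\<omega>. Top d ?I (\<lambda>j. (?Y j \<omega>)\<^sup>2) \<partial>M)"
    unfolding risk_def
  proof (intro Bochner_Integration.integral_cong refl)
    fix \<omega>
    show "Top d UNIV (\<lambda>i. (column i V \<bullet> g \<omega>)\<^sup>2) = Top d ?I (\<lambda>j. (?Y j \<omega>)\<^sup>2)"
      using Top_reindex[OF \<pi>(1), of d "\<lambda>i. (column i V \<bullet> g \<omega>)\<^sup>2"] by simp
  qed
  also have "\<dots> = (\<integral>\<omega>. Top d ?I (\<lambda>j. ((\<lambda>j\<in>?I. ?Y j \<omega>) j)\<^sup>2) \<partial>M)"
    by (intro Bochner_Integration.integral_cong Top_cong) auto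
  also have "\<dots> = (\<integral>y. Top d ?I (\<lambda>j. (y j)\<^sup>2) \<partial>distr M ?B (\<lambda>\<omega>. \<lambda>j\<in>?I. ?Y j \<omega>))"
    by (subst integral_distr) auto
  also have "\<dots> = (\<integral>z. Top d ?I (\<lambda>j. ((\<lambda>j\<in>?I. sqrt (l (\<pi> j)) * z j) j)\<^sup>2) \<partial>PiM ?I (\<lambda>_. std_normal_distribution))"
    unfolding law by (subst integral_distr) auto
  also have "\<dots> = KL d \<Sigma>"
    unfolding KL_def
    by (intro Bochner_Integration.integral_cong Top_cong)
      (auto simp: eigvals_eigenbasis[OF V eig] \<pi>(2) power_mult_distrib eigenvalue_nonneg)
  finally show ?thesis ..
qed

text \<open>A coordinate with eigenvalue 0 has second moment 0 and vanishes almost surely, so at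
  most r <= d squares are nonzero and the d largest exhaust the sum.\<close>

lemma risk_eigenbasis_low_rank:
  assumes "d \<le> CARD('p)" "rank \<Sigma> \<le> d"
  shows "risk d M g V = trace \<Sigma>"
proof -
  have zero: "AE \<omega> in M. column i V \<bullet> g \<omega> = 0" if "l i = 0" for i
  proof -
    have "(\<integral>\<omega>. (column i V \<bullet> g \<omega>)\<^sup>2 \<partial>M) = 0"
      using that by (simp add: gaussian_vector_second_moment variance_eigenbasis)
    then have "AE \<omega> in M. (column i V \<bullet> g \<omega>)\<^sup>2 = 0"
      using gaussian_vector_second_moment(1) by (subst (asm) integral_nonneg_eq_0_iff_AE) auto
    then show ?thesis by simp
  qed
  have "AE \<omega> in M. \<forall>i\<in>{i. l i = 0}. column i V \<bullet> g \<omega> = 0"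
    using zero by (intro AE_finite_allI) auto
  then have "AE \<omega> in M. Top d UNIV (\<lambda>i. (column i V \<bullet> g \<omega>)\<^sup>2) = (\<Sum>i\<in>UNIV. (column i V \<bullet> g \<omega>)\<^sup>2)"
  proof eventually_elim
    case (elim \<omega>)
    then have "{i\<in>UNIV. (column i V \<bullet> g \<omega>)\<^sup>2 \<noteq> 0} \<subseteq> {i. l i \<noteq> 0}" by auto
    from card_mono[OF _ this] have "card {i\<in>UNIV. (column i V \<bullet> g \<omega>)\<^sup>2 \<noteq> 0} \<le> d"
      using assms(2) rank_eigenbasis[OF V eig] by simp
    then show ?case using assms(1) by (intro Top_eq_sum) auto
  qed
  then have "risk d M g V = (\<integral>\<omega>. (\<Sum>i\<in>UNIV. (column i V \<bullet> g \<omega>)\<^sup>2) \<partial>M)"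
    unfolding risk_def using integrable_Top_gaussian[OF assms(1)] by (intro integral_cong_AE) auto
  also have "\<dots> = trace \<Sigma>"
    using gaussian_vector_second_moment by (simp add: trace_orthonormal_columns[OF V])
  finally show ?thesis .
qed

text \<open>Pointwise, \<open>x \<mapsto> max 0 (x z\<^sup>2 - t)\<close> is convex, and the variances of the coordinates in any
  orthonormal basis are a doubly stochastic average of the eigenvalues.\<close>

lemma risk_le_threshold:
  assumes "d \<le> CARD('p)" and U: "orthogonal_matrix U" and "0 \<le> t"
  shows "risk d M g U \<le> real d * t + (\<Sum>j\<in>UNIV. \<integral>\<omega>. max 0 ((column j V \<bullet> g \<omega>)\<^sup>2 - t) \<partial>M)"
proof -
  let ?e = "\<lambda>s z. max 0 (s * z\<^sup>2 - t)"
  let ?w = "\<lambda>i j. (column j V \<bullet> column i U)\<^sup>2"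
  have int: "integrable M (\<lambda>\<omega>. max 0 ((u \<bullet> g \<omega>)\<^sup>2 - t))" for u
    using gaussian_vector_second_moment(1)[of u] by (intro integrable_max) auto
  have pos: "0 \<le> u \<bullet> (\<Sigma> *v u)" for u using psd by (simp add: pos_semidef_def)
  have law: "(\<integral>\<omega>. max 0 ((u \<bullet> g \<omega>)\<^sup>2 - t) \<partial>M) = (\<integral>z. ?e (u \<bullet> (\<Sigma> *v u)) z \<partial>std_normal_distribution)"
    "integrable std_normal_distribution (?e (u \<bullet> (\<Sigma> *v u)))" for u
    using gaussian_vector_integral[of "\<lambda>x. max 0 (x\<^sup>2 - t)" u] int[of u] pos[of u]
    by (simp_all add: power_mult_distrib)
  \<comment> \<open>Both marginal sums of the weights are Parseval's identity. The sums over
    \<open>j\<close> serve the convexity step, the sums over \<open>i\<close> collapse the final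
    double sum.\<close>
  have row: "(\<Sum>j\<in>UNIV. ?w i j) = 1" for i
    using orthonormal_columns_parseval[OF V, of "column i U"] by (simp add: orthonormal_columns_inner[OF U])
  have col: "(\<Sum>i\<in>UNIV. ?w i j) = 1" for j
    using orthonormal_columns_parseval[OF U, of "column j V"]
    by (simp add: orthonormal_columns_inner[OF V] inner_commute)
  have conv: "?e (column i U \<bullet> (\<Sigma> *v column i U)) z \<le> (\<Sum>j\<in>UNIV. ?w i j * ?e (l j) z)" for i z
  proof -
    have "column i U \<bullet> (\<Sigma> *v column i U) * z\<^sup>2 - t = (\<Sum>j\<in>UNIV. l j * ?w i j) * z\<^sup>2 - (\<Sum>j\<in>UNIV. ?w i j) * t"
      by (simp only: quadratic_form_eigenbasis[OF V eig] row mult_1)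
    also have "\<dots> = (\<Sum>j\<in>UNIV. ?w i j * (l j * z\<^sup>2 - t))"
      unfolding sum_distrib_right sum_subtractf[symmetric] by (intro sum.cong) (auto simp: algebra_simps)
    also have "\<dots> \<le> (\<Sum>j\<in>UNIV. ?w i j * ?e (l j) z)"
      by (intro sum_mono mult_left_mono) auto
    finally have "column i U \<bullet> (\<Sigma> *v column i U) * z\<^sup>2 - t \<le> (\<Sum>j\<in>UNIV. ?w i j * ?e (l j) z)" .
    moreover have "0 \<le> (\<Sum>j\<in>UNIV. ?w i j * ?e (l j) z)" by (intro sum_nonneg) auto
    ultimately show ?thesis by simp
  qed
  have "risk d M g U \<le> (\<integral>\<omega>. real d * t + (\<Sum>i\<in>UNIV. max 0 ((column i U \<bullet> g \<omega>)\<^sup>2 - t)) \<partial>M)"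
    unfolding risk_def using assms(1) int integrable_Top_gaussian
    by (intro integral_mono) (auto intro: Top_le_threshold)
  also have "\<dots> = real d * t + (\<Sum>i\<in>UNIV. \<integral>\<omega>. max 0 ((column i U \<bullet> g \<omega>)\<^sup>2 - t) \<partial>M)"
    using int by (simp add: prob_space)
  \<comment> \<open>Only marginal laws enter here, so all coordinates can be realized by one
    standard normal \<open>z\<close> and compared pointwise.\<close>
  also have "(\<Sum>i\<in>UNIV. \<integral>\<omega>. max 0 ((column i U \<bullet> g \<omega>)\<^sup>2 - t) \<partial>M) =
      (\<integral>z. (\<Sum>i\<in>UNIV. ?e (column i U \<bullet> (\<Sigma> *v column i U)) z) \<partial>std_normal_distribution)"
    unfolding law(1) using law(2) by (intro Bochner_Integration.integral_sum[symmetric])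
  also have "\<dots> \<le> (\<integral>z. (\<Sum>i\<in>UNIV. \<Sum>j\<in>UNIV. ?w i j * ?e (l j) z) \<partial>std_normal_distribution)"
    using law(2) law(2)[of "column _ V"] conv variance_eigenbasis
    by (intro integral_mono sum_mono Bochner_Integration.integrable_sum integrable_mult_right) auto
  also have "\<dots> = (\<integral>z. (\<Sum>j\<in>UNIV. ?e (l j) z) \<partial>std_normal_distribution)"
  proof (intro Bochner_Integration.integral_cong refl)
    fix z
    show "(\<Sum>i\<in>UNIV. \<Sum>j\<in>UNIV. ?w i j * ?e (l j) z) = (\<Sum>j\<in>UNIV. ?e (l j) z)"
      by (subst sum.swap) (simp only: sum_distrib_right[symmetric] col mult_1)
  qed
  also have "\<dots> = (\<Sum>j\<in>UNIV. \<integral>\<omega>. max 0 ((column j V \<bullet> g \<omega>)\<^sup>2 - t) \<partial>M)"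
    unfolding law(1) variance_eigenbasis using law(2)[of "column _ V"] variance_eigenbasis
    by (intro Bochner_Integration.integral_sum) auto
  finally show ?thesis by simp
qed

text \<open>The level t is dictated by the eigenbasis \<open>V\<close> alone; the threshold bound
  for \<open>U\<close> holds at every nonnegative level, hence also at this one.\<close>

lemma c_const_mult_risk_le:
  assumes "0 < d" "d < rank \<Sigma>" "orthogonal_matrix U"
  shows "c_const d (rank \<Sigma>) * risk d M g U \<le> risk d M g V"
proof -
  define R where "R = {i. l i \<noteq> 0}"
  have r: "rank \<Sigma> = card R" by (simp add: R_def rank_eigenbasis[OF V eig])
  have dp: "d \<le> CARD('p)"
    using assms(2) card_mono[of UNIV R] by (simp add: r)
  have c: "0 \<le> c_const d (card R)"
    using gamma_const_pos[OF assms(1)] gamma_const_le_c_const[OF assms(2)] by (simp add: r)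
  let ?X = "\<lambda>i \<omega>. (column i V \<bullet> g \<omega>)\<^sup>2"
  have "indep_vars (\<lambda>_. borel) (\<lambda>i \<omega>. column i V \<bullet> g \<omega>) R"
    using indep_vars_eigenbasis[of R "\<lambda>i. i"] by simp
  from indep_vars_compose[OF this, of "\<lambda>_ x. x\<^sup>2" "\<lambda>_. borel"]
  have indep: "indep_vars (\<lambda>_. borel) ?X R" by (simp add: comp_def)
  obtain t where t: "0 \<le> t"
    "c_const d (card R) * (real d * t + (\<Sum>i\<in>R. \<integral>\<omega>. max 0 (?X i \<omega> - t) \<partial>M)) \<le> (\<integral>\<omega>. Top d UNIV (\<lambda>i. ?X i \<omega>) \<partial>M)"
    by (rule expectation_Top_indep_ge[of UNIV R d ?X])
      (use assms(1,2) c indep gaussian_vector_second_moment(1) in \<open>auto simp: r\<close>)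
  \<comment> \<open>Outside \<open>R\<close> the coordinate has variance 0, hence no excess over the
    nonnegative level t.\<close>
  have "(\<integral>\<omega>. max 0 (?X i \<omega> - t) \<partial>M) = 0" if "i \<notin> R" for i
    using gaussian_vector_integral(1)[of "\<lambda>x. max 0 (x\<^sup>2 - t)" "column i V"] that t(1)
    by (simp add: variance_eigenbasis R_def max_absorb1)
  then have "(\<Sum>i\<in>UNIV. \<integral>\<omega>. max 0 (?X i \<omega> - t) \<partial>M) = (\<Sum>i\<in>R. \<integral>\<omega>. max 0 (?X i \<omega> - t) \<partial>M)"
    by (intro sum.mono_neutral_right) auto
  with risk_le_threshold[OF dp assms(3) t(1)]
  have "risk d M g U \<le> real d * t + (\<Sum>i\<in>R. \<integral>\<omega>. max 0 (?X i \<omega> - t) \<partial>M)" by simp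
  then have "c_const d (card R) * risk d M g U \<le>
      c_const d (card R) * (real d * t + (\<Sum>i\<in>R. \<integral>\<omega>. max 0 (?X i \<omega> - t) \<partial>M))"
    using c by (rule mult_left_mono)
  with t(2) show ?thesis by (simp add: r risk_def)
qed

end

end

theorem theorem2:
  fixes M :: "'w measure" and g :: "'w \<Rightarrow> real^'p" and \<Sigma> :: "real^'p^'p" and d :: nat
  assumes "prob_space M"
    and "1 \<le> d" and "d \<le> CARD('p)"
    and "pos_semidef \<Sigma>"
    and "gaussian_vector M g \<Sigma>"
  shows "(rank \<Sigma> \<le> d \<longrightarrow> OPT d M g = KL d \<Sigma> \<and> KL d \<Sigma> = trace \<Sigma>) \<and>
    (d < rank \<Sigma> \<longrightarrow>
       KL d \<Sigma> \<le> OPT d M g \<and>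
       OPT d M g \<le> inverse (c_const d (rank \<Sigma>)) * KL d \<Sigma> \<and>
       inverse (c_const d (rank \<Sigma>)) * KL d \<Sigma> \<le> inverse (gamma_const d) * KL d \<Sigma>) \<and>
    (\<lambda>n. inverse (gamma_const n) - (1 + 1 / sqrt (2 * pi * real n))) \<in> O(\<lambda>n. 1 / real n) \<and>
    (\<lambda>n. inverse (gamma_const n) - 1) \<in> O(\<lambda>n. real n powr (- 1 / 2))"
proof -
  note gv = assms(1,4,5)
  have "transpose \<Sigma> = \<Sigma>" using assms(4) by (simp add: pos_semidef_def)
  then obtain V l where V: "orthogonal_matrix V" and eig: "\<And>i. \<Sigma> *v column i V = l i *\<^sub>R column i V"
    using symmetric_matrix_orthonormal_eigenbasis by blast
  have KL: "KL d \<Sigma> = risk d M g V"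
    by (rule KL_eq_risk_eigenbasis[OF gv V eig assms(3)])
  have ge: "KL d \<Sigma> \<le> OPT d M g"
    unfolding KL OPT_def using V bdd_above_risk[OF gv assms(3)] by (intro cSUP_upper) auto
  have le: "OPT d M g \<le> b" if "\<And>U. orthogonal_matrix U \<Longrightarrow> risk d M g U \<le> b" for b
    unfolding OPT_def using V that by (intro cSUP_least) auto
  have "OPT d M g = KL d \<Sigma> \<and> KL d \<Sigma> = trace \<Sigma>" if "rank \<Sigma> \<le> d"
  proof -
    have "KL d \<Sigma> = trace \<Sigma>"
      unfolding KL by (rule risk_eigenbasis_low_rank[OF gv V eig assms(3) that])
    moreover have "OPT d M g \<le> trace \<Sigma>"
      by (rule le) (rule risk_le_trace[OF gv assms(3)])
    ultimately show ?thesis using ge by simp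
  qed
  moreover have "OPT d M g \<le> inverse (c_const d (rank \<Sigma>)) * KL d \<Sigma> \<and>
      inverse (c_const d (rank \<Sigma>)) * KL d \<Sigma> \<le> inverse (gamma_const d) * KL d \<Sigma>" if "d < rank \<Sigma>"
  proof
    \<comment> \<open>\<open>c_const\<close> inherits positivity from \<open>gamma_const\<close>,
      which permits the division below.\<close>
    have \<gamma>: "0 < gamma_const d" using assms(2) by (intro gamma_const_pos) simp
    have c: "gamma_const d \<le> c_const d (rank \<Sigma>)" by (rule gamma_const_le_c_const) fact
    show "OPT d M g \<le> inverse (c_const d (rank \<Sigma>)) * KL d \<Sigma>"
    proof (rule le)
      fix U :: "real^'p^'p" assume "orthogonal_matrix U"
      then have "c_const d (rank \<Sigma>) * risk d M g U \<le> KL d \<Sigma>"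
        unfolding KL using assms(2) that by (intro c_const_mult_risk_le[OF gv V eig]) auto
      then show "risk d M g U \<le> inverse (c_const d (rank \<Sigma>)) * KL d \<Sigma>"
        using \<gamma> c by (simp add: field_simps)
    qed
    have "0 \<le> KL d \<Sigma>"
      unfolding KL risk_def using assms(3)
      by (intro Bochner_Integration.integral_nonneg Top_nonneg) auto
    then show "inverse (c_const d (rank \<Sigma>)) * KL d \<Sigma> \<le> inverse (gamma_const d) * KL d \<Sigma>"
      using \<gamma> c by (intro mult_right_mono le_imp_inverse_le)
  qed
  ultimately show ?thesis
    using ge inverse_gamma_const_asymp inverse_gamma_const_asymp_weak by blast
qed

end
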